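(* Let $G=(V,E)$ be a connected graph and let $C=(V_C,E_C)$ be a cycle in $G$. Let $5\le k\le|V_C|$ with $k$ odd, $d=\frac{k-1}{2}$, and let $v:\mathbb{Z}_k\to V_C$ be injective and true to $C$. Then the half-chorded odd cycle inequality $\sum_{i\in\mathbb{Z}_k}(x_{v_iv_{i+d}}-x_{v_iv_{i+1}})\le k-3$ is facet-defining for $\mathrm{LMC}(G)$.
   Context: Indices of $v$ are taken modulo $k$. Let $m=|V_C|$ and identify $V_C$ with $\mathbb{Z}_m$ so that $E_C=\{\{u,u+1\}:u\in\mathbb{Z}_m\}$. For $a,b\in\mathbb{Z}_m$, $[a,b]=\{a,a+1,\dots,b\}$ (forward along the cycle), $[a,b[\,=[a,b]\setminus\{b\}$, $]a,b]=[a,b]\setminus\{a\}$. The sequence $v$ is true to $C$ if either $v_i\in[v_0,v_{i+1}[$ for all $i=0,\dots,k-2$, or $v_i\in\,]v_{i+1},v_0]$ for all $i=0,\dots,k-2$. A decomposition of $G$ is a partition of $V$ whose blocks induce connected subgraphs of $G$; its lifted multicut is the set of pairs $ab\in\binom{V}{2}$ with $a,b$ in distinct blocks. $\mathrm{LMC}(G)\subseteq\mathbb{R}^{\binom{V}{2}}$ is the convex hull of the characteristic vectors of these lifted multicuts over all decompositions of $G$. *)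

theory Defs
  imports "HOL-Analysis.Analysis" "HOL-Library.Disjoint_Sets"
begin

definition pairs :: "'v set \<Rightarrow> 'v set set" where
  "pairs V = {e. e \<subseteq> V \<and> card e = 2}"

definition simple_graph :: "'v set \<Rightarrow> 'v set set \<Rightarrow> bool" where
  "simple_graph V E \<longleftrightarrow> finite V \<and> E \<subseteq> pairs V"

definition connected_graph :: "'v set \<Rightarrow> 'v set set \<Rightarrow> bool" where
  "connected_graph V E \<longleftrightarrow>
     simple_graph V E \<and> V \<noteq> {} \<and> (\<forall>a\<in>V. \<forall>b\<in>V. (a, b) \<in> {(p, q). {p, q} \<in> E}\<^sup>*)"

definition induced_edges :: "'v set set \<Rightarrow> 'v set \<Rightarrow> 'v set set" where
  "induced_edges E B = {e \<in> E. e \<subseteq> B}"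

definition decomposition :: "'v set \<Rightarrow> 'v set set \<Rightarrow> 'v set set \<Rightarrow> bool" where
  "decomposition V E P \<longleftrightarrow>
     partition_on V P \<and> (\<forall>B\<in>P. connected_graph B (induced_edges E B))"

definition lifted_multicut :: "'v set set \<Rightarrow> 'v set set" where
  "lifted_multicut P = {{a, b} | a b. \<exists>A\<in>P. \<exists>B\<in>P. A \<noteq> B \<and> a \<in> A \<and> b \<in> B}"

definition char_vec :: "'v set set \<Rightarrow> real ^ ('v::finite set)" where
  "char_vec M = (\<chi> e. if e \<in> M then 1 else 0)"

text \<open>
  The space of real vectors indexed by the two-element subsets of \<open>V\<close> is represented as the
  coordinate subspace of \<open>real ^ ('v set)\<close> on which all other coordinates vanish; lifted multicuts
  only contain two-element subsets of \<open>V\<close>, so \<open>LMC\<close> lies in this subspace. Faces and affine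
  dimensions do not depend on the ambient space.
\<close>

definition LMC :: "'v::finite set \<Rightarrow> 'v set set \<Rightarrow> (real ^ ('v set)) set" where
  "LMC V E = convex hull {char_vec (lifted_multicut P) | P. decomposition V E P}"

definition facet_defining :: "'a::euclidean_space set \<Rightarrow> ('a \<Rightarrow> real) \<Rightarrow> real \<Rightarrow> bool" where
  "facet_defining P f b \<longleftrightarrow>
     linear f \<and> (\<forall>x\<in>P. f x \<le> b) \<and> {x \<in> P. f x = b} facet_of P"

text \<open>
  The integers modulo \<open>m\<close> are represented by \<open>{..<m}\<close>. The map \<open>c\<close> is the identification of
  the integers modulo \<open>card V\<^sub>C\<close> with the vertex set of the cycle.
\<close>

definition cycle_labelling :: "(nat \<Rightarrow> 'v) \<Rightarrow> 'v set \<Rightarrow> 'v set set \<Rightarrow> bool" where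
  "cycle_labelling c V\<^sub>C E\<^sub>C \<longleftrightarrow>
     3 \<le> card V\<^sub>C \<and> bij_betw c {..<card V\<^sub>C} V\<^sub>C \<and>
     E\<^sub>C = {{c u, c ((u + 1) mod card V\<^sub>C)} | u. u < card V\<^sub>C}"

text \<open>
  For \<open>a, b < m\<close>, the number of forward steps from \<open>a\<close> to \<open>b\<close> is \<open>(b + m - a) mod m\<close>.
\<close>

definition cyc_cc :: "nat \<Rightarrow> nat \<Rightarrow> nat \<Rightarrow> nat set" where
  "cyc_cc m a b = {(a + j) mod m | j. j \<le> (b + m - a) mod m}"

definition cyc_co :: "nat \<Rightarrow> nat \<Rightarrow> nat \<Rightarrow> nat set" where
  "cyc_co m a b = cyc_cc m a b - {b}"

definition cyc_oc :: "nat \<Rightarrow> nat \<Rightarrow> nat \<Rightarrow> nat set" where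
  "cyc_oc m a b = cyc_cc m a b - {a}"

definition true_to_cycle :: "(nat \<Rightarrow> 'v) \<Rightarrow> 'v set \<Rightarrow> nat \<Rightarrow> (nat \<Rightarrow> 'v) \<Rightarrow> bool" where
  "true_to_cycle c V\<^sub>C k v \<longleftrightarrow>
     (let m = card V\<^sub>C; p = (\<lambda>i. the_inv_into {..<m} c (v i)) in
       (\<forall>i<k - 1. p i \<in> cyc_co m (p 0) (p (i + 1))) \<or>
       (\<forall>i<k - 1. p i \<in> cyc_oc m (p (i + 1)) (p 0)))"

end

theory Submission
  imports Defs
begin

text \<open>
  Call the \<open>v\<^sub>i\<close> terminals. A decomposition attains equality iff it splits the terminals either into
  two cyclic intervals of sizes \<open>d\<close> and \<open>d + 1\<close>, or into three cyclic intervals of size at most \<open>d\<close>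
  each; all other vertices are free. Let \<open>\<alpha>\<close> be a linear functional that is constant on the tight
  decompositions. If two vertices \<open>x\<close>, \<open>y\<close> can independently leave a common block without destroying
  tightness, then the alternating sum over the four resulting decompositions gives \<open>\<alpha>\<^bsub>xy\<^esub> = 0\<close>. Taking the
  common block to be a walk that meets the cycle in an arc with at most \<open>d + 1\<close> terminals, this
  applies to all pairs except \<open>v\<^sub>i v\<^bsub>i+1\<^esub>\<close> and \<open>v\<^sub>i v\<^bsub>i+d\<^esub>\<close>. Moving \<open>v\<^sub>i\<close> alone out of \<open>{v\<^sub>i, \<dots>, v\<^bsub>i+d\<^esub>}\<close>
  gives \<open>\<alpha>\<^bsub>i,i+1\<^esub> = - \<alpha>\<^bsub>i,i+d\<^esub>\<close>, and moving it between two neighbouring intervals gives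
  \<open>\<alpha>\<^bsub>i,i+1\<^esub> = \<alpha>\<^bsub>i-1,i\<^esub>\<close>. Hence \<open>\<alpha>\<close> is a multiple of the functional of the inequality, which bounds the
  codimension of the tight face by one.
\<close>

subsection \<open>Walks and cut weights of labellings\<close>

abbreviation walk :: "'v set set \<Rightarrow> 'v list \<Rightarrow> bool" where
  "walk E \<equiv> successively (\<lambda>a b. {a, b} \<in> E)"

lemma walk_reach_from_hd:
  assumes "walk E xs" "b \<in> set xs"
  shows "(hd xs, b) \<in> {(p, q). {p, q} \<in> induced_edges E (set xs)}\<^sup>*"
  using assms
proof (induction xs)
  case Nil
  then show ?case by simp
next
  case (Cons x xs)
  show ?case
  proof (cases "b = x \<or> xs = []")
    case True
    with Cons.prems show ?thesis by auto
  next
    case False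
    with Cons.prems have b: "b \<in> set xs" and w: "walk E xs" and e: "{x, hd xs} \<in> E"
      by (auto simp: successively_Cons)
    have "{(p, q). {p, q} \<in> induced_edges E (set xs)}\<^sup>* \<subseteq>
          {(p, q). {p, q} \<in> induced_edges E (set (x # xs))}\<^sup>*"
      by (rule rtrancl_mono) (auto simp: induced_edges_def)
    with Cons.IH[OF w b] have "(hd xs, b) \<in> {(p, q). {p, q} \<in> induced_edges E (set (x # xs))}\<^sup>*"
      by blast
    moreover have "(x, hd xs) \<in> {(p, q). {p, q} \<in> induced_edges E (set (x # xs))}"
      using e False by (auto simp: induced_edges_def)
    ultimately show ?thesis by (simp add: converse_rtrancl_into_rtrancl)
  qed
qed

lemma connected_graph_walk:
  assumes "simple_graph V E" "walk E xs" "xs \<noteq> []"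
  shows "connected_graph (set xs) (induced_edges E (set xs))"
proof -
  let ?R = "{(p, q). {p, q} \<in> induced_edges E (set xs)}"
  have "sym ?R" by (auto simp: sym_def insert_commute)
  then have s: "sym (?R\<^sup>*)" by (rule sym_rtrancl)
  have "(a, b) \<in> ?R\<^sup>*" if "a \<in> set xs" "b \<in> set xs" for a b
    using walk_reach_from_hd[OF assms(2) that(1)] walk_reach_from_hd[OF assms(2) that(2)] s
    by (meson rtrancl_trans symD)
  moreover have "simple_graph (set xs) (induced_edges E (set xs))"
    using assms(1) by (auto simp: simple_graph_def induced_edges_def pairs_def)
  ultimately show ?thesis using assms(3) by (simp add: connected_graph_def)
qed

lemma doubleton_in_pairs_iff: "{a, b} \<in> pairs V \<longleftrightarrow> a \<in> V \<and> b \<in> V \<and> a \<noteq> b"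
  by (auto simp: pairs_def card_insert_if)

lemma pairs_cases:
  assumes "e \<in> pairs V"
  obtains a b where "e = {a, b}" "a \<in> V" "b \<in> V" "a \<noteq> b"
  using assms by (auto simp: pairs_def card_2_iff)

lemma sum_pairs_remove:
  fixes F :: "'v set \<Rightarrow> real"
  assumes "finite V" "x \<in> V"
  shows "(\<Sum>e\<in>pairs V. F e) = (\<Sum>e\<in>pairs (V - {x}). F e) + (\<Sum>z\<in>V - {x}. F {x, z})"
proof -
  have eq: "pairs V = pairs (V - {x}) \<union> (\<lambda>z. {x, z}) ` (V - {x})"
  proof (rule set_eqI)
    fix e
    show "e \<in> pairs V \<longleftrightarrow> e \<in> pairs (V - {x}) \<union> (\<lambda>z. {x, z}) ` (V - {x})"
    proof
      assume "e \<in> pairs V"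
      then obtain a b where "e = {a, b}" "a \<in> V" "b \<in> V" "a \<noteq> b" by (rule pairs_cases)
      then show "e \<in> pairs (V - {x}) \<union> (\<lambda>z. {x, z}) ` (V - {x})"
        by (cases "a = x"; cases "b = x") (auto simp: doubleton_in_pairs_iff)
    next
      assume "e \<in> pairs (V - {x}) \<union> (\<lambda>z. {x, z}) ` (V - {x})"
      then show "e \<in> pairs V" using assms(2) by (auto simp: pairs_def card_insert_if)
    qed
  qed
  have fin: "finite (pairs (V - {x}))"
    using assms(1) by (auto simp: pairs_def)
  have "pairs (V - {x}) \<inter> (\<lambda>z. {x, z}) ` (V - {x}) = {}"
    by (auto simp: pairs_def)
  moreover have "inj_on (\<lambda>z. {x, z}) (V - {x})"
    by (auto simp: inj_on_def doubleton_eq_iff)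
  ultimately show ?thesis
    unfolding eq using fin assms(1)
    by (subst sum.union_disjoint) (auto simp: sum.reindex)
qed

text \<open>A labelling \<open>g\<close> stands for the decomposition into its fibres; the separated
  pairs then form its lifted multicut.\<close>

definition separates :: "('v \<Rightarrow> 'l) \<Rightarrow> 'v set \<Rightarrow> bool" where
  "separates g e \<longleftrightarrow> (\<exists>a\<in>e. \<exists>b\<in>e. g a \<noteq> g b)"

text \<open>The value of the linear functional with coefficients \<open>\<alpha>\<close> at the
  characteristic vector of the lifted multicut given by the fibres of \<open>g\<close>.\<close>

definition cut_weight :: "'v set \<Rightarrow> ('v set \<Rightarrow> real) \<Rightarrow> ('v \<Rightarrow> 'l) \<Rightarrow> real" where
  "cut_weight V \<alpha> g = (\<Sum>e\<in>pairs V. \<alpha> e * of_bool (separates g e))"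

definition connected_fibres :: "'v set \<Rightarrow> 'v set set \<Rightarrow> ('v \<Rightarrow> 'l) \<Rightarrow> bool" where
  "connected_fibres V E g \<longleftrightarrow>
     (\<forall>z\<in>V. connected_graph {u \<in> V. g u = g z} (induced_edges E {u \<in> V. g u = g z}))"

lemma separates_doubleton [simp]: "separates g {a, b} \<longleftrightarrow> g a \<noteq> g b"
  by (auto simp: separates_def)

lemma cut_weight_update:
  assumes "finite V" "x \<in> V"
  shows "cut_weight V \<alpha> (h(x := p)) =
    cut_weight (V - {x}) \<alpha> h + (\<Sum>z\<in>V - {x}. \<alpha> {x, z} * of_bool (h z \<noteq> p))"
proof -
  have "separates (h(x := p)) e = separates h e" if "e \<in> pairs (V - {x})" for e
    using that by (auto simp: separates_def pairs_def subset_iff)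
  then show ?thesis
    unfolding cut_weight_def sum_pairs_remove[OF assms]
    by (intro arg_cong2[where f = "(+)"] sum.cong) auto
qed

text \<open>Pairs avoiding \<open>x\<close> contribute equally on both sides, as does the total
  weight at \<open>x\<close>. What remains is the uncut weight from \<open>x\<close> to the block
  that it joins.\<close>

lemma cut_weight_move:
  assumes "finite V" "x \<in> V" and "cut_weight V \<alpha> (h(x := p)) = cut_weight V \<alpha> (h(x := r))"
  shows "(\<Sum>z | z \<in> V - {x} \<and> h z = p. \<alpha> {x, z}) = (\<Sum>z | z \<in> V - {x} \<and> h z = r. \<alpha> {x, z})"
proof -
  have *: "(\<Sum>z\<in>V - {x}. \<alpha> {x, z} * of_bool (h z \<noteq> p)) =
      (\<Sum>z\<in>V - {x}. \<alpha> {x, z}) - (\<Sum>z | z \<in> V - {x} \<and> h z = p. \<alpha> {x, z})" for p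
  proof -
    have "(\<Sum>z | z \<in> V - {x} \<and> h z = p. \<alpha> {x, z}) = (\<Sum>z\<in>V - {x}. \<alpha> {x, z} * of_bool (h z = p))"
      using assms(1) by (intro sum.mono_neutral_cong_left) auto
    then show ?thesis
      by (simp add: sum_subtractf[symmetric] of_bool_def if_distrib cong: if_cong) (rule sum.cong, auto)
  qed
  show ?thesis using assms(3) unfolding cut_weight_update[OF assms(1,2)] * by simp
qed

text \<open>The second difference of the cut weight under independent relabellings of \<open>x\<close> and \<open>y\<close>
  isolates the weight of \<open>{x, y}\<close>.\<close>

lemma cut_weight_four_labellings:
  assumes "finite V" "x \<in> V" "y \<in> V" "x \<noteq> y"
    and "l \<noteq> p" "r \<noteq> p" "l \<noteq> r"
    and "cut_weight V \<alpha> (h(x := p, y := p)) = \<kappa>" "cut_weight V \<alpha> (h(x := l, y := p)) = \<kappa>"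
    and "cut_weight V \<alpha> (h(x := p, y := r)) = \<kappa>" "cut_weight V \<alpha> (h(x := l, y := r)) = \<kappa>"
  shows "\<alpha> {x, y} = 0"
proof -
  define X where "X = (\<lambda>s. \<Sum>z\<in>V - {y} - {x}. \<alpha> {x, z} * of_bool (h z \<noteq> s))"
  define Y where "Y = (\<lambda>s. \<Sum>z\<in>V - {y} - {x}. \<alpha> {y, z} * of_bool (h z \<noteq> s))"
  have "cut_weight V \<alpha> (h(x := s, y := s')) = cut_weight (V - {y} - {x}) \<alpha> h + X s + Y s'
          + \<alpha> {x, y} * of_bool (s \<noteq> s')" for s s'
  proof -
    have "cut_weight V \<alpha> (h(x := s, y := s')) =
       cut_weight (V - {y}) \<alpha> (h(x := s)) + (\<Sum>z\<in>V - {y}. \<alpha> {y, z} * of_bool ((h(x := s)) z \<noteq> s'))"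
      using assms by (intro cut_weight_update) auto
    moreover have "cut_weight (V - {y}) \<alpha> (h(x := s)) = cut_weight (V - {y} - {x}) \<alpha> h + X s"
      unfolding X_def using assms by (intro cut_weight_update) auto
    moreover have "(\<Sum>z\<in>V - {y}. \<alpha> {y, z} * of_bool ((h(x := s)) z \<noteq> s')) =
       \<alpha> {y, x} * of_bool (s \<noteq> s') + Y s'"
      using assms unfolding Y_def by (subst sum.remove[of _ x]) (auto intro!: sum.cong)
    ultimately show ?thesis by (simp add: insert_commute)
  qed
  then show ?thesis using assms(5-) by simp
qed

subsection \<open>Labellings of the terminals\<close>

lemma sum_periodic:
  fixes F :: "int \<Rightarrow> 'a::ab_group_add"
  assumes "k > 0" and per: "\<And>i. F (i + k) = F i"
  shows "(\<Sum>i\<in>{a..<a + k}. F i) = (\<Sum>i\<in>{0..<k}. F i)"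
proof -
  have step: "(\<Sum>i\<in>{a + 1..<a + 1 + k}. F i) = (\<Sum>i\<in>{a..<a + k}. F i)" for a
  proof -
    have "{a..<a + k} = insert a {a + 1..<a + k}" "{a + 1..<a + 1 + k} = insert (a + k) {a + 1..<a + k}"
      using assms(1) by auto
    then show ?thesis using per[of a] by simp
  qed
  show ?thesis
  proof (induction a rule: int_induct[where k = 0])
    case (step2 i)
    then show ?case using step[of "i - 1"] by simp
  qed (use step in auto)
qed

text \<open>The left-hand side of the inequality at a lifted multicut, where \<open>g i\<close>
  names the block of the terminal with index \<open>i\<close>. Indices modulo \<open>k\<close> are
  replaced by a \<open>k\<close>-periodic \<open>g\<close> on the integers, so that a window of
  length \<open>k\<close> may start anywhere.\<close>

definition excess :: "int \<Rightarrow> int \<Rightarrow> (int \<Rightarrow> 'l) \<Rightarrow> int" where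
  "excess k d g = (\<Sum>i\<in>{0..<k}. of_bool (g i \<noteq> g (i + d)) - of_bool (g i \<noteq> g (i + 1)))"

lemma excess_window:
  assumes "k > 0" and "\<And>i. g (i + k) = g i"
  shows "excess k d g = (\<Sum>i\<in>{a..<a + k}. of_bool (g i \<noteq> g (i + d))) - (\<Sum>i\<in>{a..<a + k}. of_bool (g i \<noteq> g (i + 1)))"
proof -
  have "g (i + k + d) = g (i + d)" "g (i + k + 1) = g (i + 1)" for i
    using assms(2)[of "i + d"] assms(2)[of "i + 1"] by (simp_all add: algebra_simps)
  then show ?thesis
    unfolding excess_def sum_subtractf[symmetric]
    by (intro sum_periodic[symmetric]) (use assms in auto)
qed

text \<open>Reversal sends two indices at distance \<open>e\<close> to two indices at distance
  \<open>e\<close>, so cut steps and cut chords are counted alike. This later allows the cycle to be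
  traversed backwards.\<close>

lemma excess_reflect:
  fixes h :: "int \<Rightarrow> 'l"
  assumes "k > 0" and per: "\<And>i. h (i + k) = h i"
  shows "excess k d (\<lambda>i. h (- i)) = excess k d h"
proof -
  have *: "(\<Sum>i\<in>{0..<k}. of_bool (h (- i) \<noteq> h (- (i + e)))) = (\<Sum>i\<in>{0..<k}. of_bool (h i \<noteq> h (i + e)) :: int)"
    for e
  proof -
    have "h (i + k + e) = h (i + e)" for i using per[of "i + e"] by (simp add: algebra_simps)
    \<comment> \<open>The window on the right is the image of \<open>{0..<k}\<close> under
      \<open>\<lambda>i. - (i + e)\<close>.\<close>
    then have "(\<Sum>i\<in>{0..<k}. of_bool (h i \<noteq> h (i + e)) :: int) =
        (\<Sum>i\<in>{1 - e - k..<1 - e - k + k}. of_bool (h i \<noteq> h (i + e)))"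
      using assms by (intro sum_periodic[symmetric]) auto
    also have "\<dots> = (\<Sum>i\<in>{0..<k}. of_bool (h (- i) \<noteq> h (- (i + e))))"
      by (rule sum.reindex_bij_witness[of _ "\<lambda>i. - (i + e)" "\<lambda>i. - (i + e)"]) (auto simp: add.commute)
    finally show ?thesis by simp
  qed
  show ?thesis unfolding excess_def sum_subtractf * by simp
qed

text \<open>Intervals of size at most \<open>d\<close> contain no chord: \<open>i + d\<close> is
  \<open>d\<close> steps ahead of \<open>i\<close> and \<open>d + 1\<close> steps behind
  \<open>i + k\<close>. So all \<open>k\<close> chords are cut, and exactly three steps.\<close>

lemma excess_three_intervals:
  fixes g :: "int \<Rightarrow> 'l"
  assumes k: "k = 2 * d + 1" and per: "\<And>i. g (i + k) = g i"
    and ord: "i\<^sub>1 < i\<^sub>2" "i\<^sub>2 < i\<^sub>3" "i\<^sub>3 < i\<^sub>1 + k"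
    and len: "i\<^sub>2 - i\<^sub>1 \<le> d" "i\<^sub>3 - i\<^sub>2 \<le> d" "i\<^sub>1 + k - i\<^sub>3 \<le> d"
    and lab: "\<And>i. i\<^sub>1 \<le> i \<Longrightarrow> i < i\<^sub>2 \<Longrightarrow> g i = l\<^sub>1" "\<And>i. i\<^sub>2 \<le> i \<Longrightarrow> i < i\<^sub>3 \<Longrightarrow> g i = l\<^sub>2"
      "\<And>i. i\<^sub>3 \<le> i \<Longrightarrow> i < i\<^sub>1 + k \<Longrightarrow> g i = l\<^sub>3"
    and dist: "l\<^sub>1 \<noteq> l\<^sub>2" "l\<^sub>1 \<noteq> l\<^sub>3" "l\<^sub>2 \<noteq> l\<^sub>3"
  shows "excess k d g = k - 3"
proof -
  \<comment> \<open>\<open>G\<close> unrolls the labelling past one period, far enough to contain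
    \<open>i + d\<close> for every \<open>i\<close> in the window.\<close>
  define G where "G i = (if i < i\<^sub>2 then l\<^sub>1 else if i < i\<^sub>3 then l\<^sub>2 else if i < i\<^sub>1 + k then l\<^sub>3
     else if i < i\<^sub>2 + k then l\<^sub>1 else l\<^sub>2)" for i
  have G: "g i = G i" if "i\<^sub>1 \<le> i" "i < i\<^sub>3 + k" for i
  proof (cases "i < i\<^sub>1 + k")
    case True
    then show ?thesis using that lab ord by (auto simp: G_def)
  next
    case False
    then show ?thesis using that lab[of "i - k"] ord per[of "i - k"] by (auto simp: G_def)
  qed
  have "(\<Sum>i\<in>{i\<^sub>1..<i\<^sub>1 + k}. of_bool (g i \<noteq> g (i + d)) :: int) = (\<Sum>i\<in>{i\<^sub>1..<i\<^sub>1 + k}. 1)"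
  proof (rule sum.cong)
    fix i assume i: "i \<in> {i\<^sub>1..<i\<^sub>1 + k}"
    have "g i = G i" "g (i + d) = G (i + d)" using i ord len k by (auto intro!: G)
    moreover have "G i \<noteq> G (i + d)"
      using i ord len k dist by (auto simp: G_def)
    ultimately show "of_bool (g i \<noteq> g (i + d)) = (1 :: int)" by simp
  qed simp
  moreover have "(\<Sum>i\<in>{i\<^sub>1..<i\<^sub>1 + k}. of_bool (g i \<noteq> g (i + 1)) :: int) =
    (\<Sum>i\<in>{i\<^sub>2 - 1, i\<^sub>3 - 1, i\<^sub>1 + k - 1}. 1)"
  proof (rule sum.mono_neutral_cong_right)
    show "\<forall>i\<in>{i\<^sub>1..<i\<^sub>1 + k} - {i\<^sub>2 - 1, i\<^sub>3 - 1, i\<^sub>1 + k - 1}. of_bool (g i \<noteq> g (i + 1)) = (0 :: int)"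
      using ord by (auto simp: G G_def)
    fix i assume "i \<in> {i\<^sub>2 - 1, i\<^sub>3 - 1, i\<^sub>1 + k - 1}"
    then show "of_bool (g i \<noteq> g (i + 1)) = (1 :: int)"
      using ord dist by (auto simp: G G_def)
  qed (use ord in auto)
  ultimately show ?thesis
    using excess_window[of k g d i\<^sub>1] per k ord len by simp
qed

text \<open>The only uncut chord joins the two ends of the interval of size \<open>d + 1\<close>;
  this leaves \<open>k - 1\<close> cut chords and two cut steps.\<close>

lemma excess_two_intervals:
  fixes g :: "int \<Rightarrow> 'l"
  assumes k: "k = 2 * d + 1" "1 \<le> d" and per: "\<And>i. g (i + k) = g i"
    and lab: "\<And>i. i\<^sub>1 \<le> i \<Longrightarrow> i < i\<^sub>1 + d \<Longrightarrow> g i = l\<^sub>1" "\<And>i. i\<^sub>1 + d \<le> i \<Longrightarrow> i < i\<^sub>1 + k \<Longrightarrow> g i = l\<^sub>2"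
    and dist: "l\<^sub>1 \<noteq> l\<^sub>2"
  shows "excess k d g = k - 3"
proof -
  define G where "G i = (if i < i\<^sub>1 + d then l\<^sub>1 else if i < i\<^sub>1 + k then l\<^sub>2 else l\<^sub>1)" for i
  have G: "g i = G i" if "i\<^sub>1 \<le> i" "i < i\<^sub>1 + d + k" for i
  proof (cases "i < i\<^sub>1 + k")
    case True
    then show ?thesis using that lab k by (auto simp: G_def)
  next
    case False
    then show ?thesis using that lab[of "i - k"] k per[of "i - k"] by (auto simp: G_def)
  qed
  have "(\<Sum>i\<in>{i\<^sub>1..<i\<^sub>1 + k}. of_bool (g i \<noteq> g (i + d)) :: int) = (\<Sum>i\<in>{i\<^sub>1..<i\<^sub>1 + k} - {i\<^sub>1 + d}. 1)"
  proof (rule sum.mono_neutral_cong_right)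
    have "g (i\<^sub>1 + d) = g (i\<^sub>1 + d + d)" using k by (subst (1 2) G) (auto simp: G_def)
    then show "\<forall>i\<in>{i\<^sub>1..<i\<^sub>1 + k} - ({i\<^sub>1..<i\<^sub>1 + k} - {i\<^sub>1 + d}). of_bool (g i \<noteq> g (i + d)) = (0 :: int)"
      by auto
  next
    fix i assume i: "i \<in> {i\<^sub>1..<i\<^sub>1 + k} - {i\<^sub>1 + d}"
    have "g i = G i" "g (i + d) = G (i + d)" using i k by (auto intro!: G)
    moreover have "G i \<noteq> G (i + d)"
      using i k dist by (auto simp: G_def)
    ultimately show "of_bool (g i \<noteq> g (i + d)) = (1 :: int)" by simp
  qed auto
  moreover have "(\<Sum>i\<in>{i\<^sub>1..<i\<^sub>1 + k}. of_bool (g i \<noteq> g (i + 1)) :: int) =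
    (\<Sum>i\<in>{i\<^sub>1 + d - 1, i\<^sub>1 + k - 1}. 1)"
  proof (rule sum.mono_neutral_cong_right)
    show "\<forall>i\<in>{i\<^sub>1..<i\<^sub>1 + k} - {i\<^sub>1 + d - 1, i\<^sub>1 + k - 1}. of_bool (g i \<noteq> g (i + 1)) = (0 :: int)"
      using k by (auto simp: G G_def)
    fix i assume "i \<in> {i\<^sub>1 + d - 1, i\<^sub>1 + k - 1}"
    then show "of_bool (g i \<noteq> g (i + 1)) = (1 :: int)"
      using k dist by (auto simp: G G_def)
  qed (use k in auto)
  ultimately show ?thesis
    using excess_window[of k g d i\<^sub>1] per k by simp
qed

section \<open>Validity of the inequality for periodic labellings\<close>

lemma constant_on_interval:
  fixes g :: "int \<Rightarrow> 'l"
  assumes "a \<le> b" and "\<And>i. a \<le> i \<Longrightarrow> i < b \<Longrightarrow> g i = g (i + 1)"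
  shows "g a = g b"
  using assms by (induction b rule: int_ge_induct) auto

text \<open>By the number of cut steps. None: everything is constant. One: impossible on a cycle. At
  least three: there are only \<open>k\<close> chords. Exactly two: one of the two intervals has at
  least \<open>d + 1\<close> terminals and hence an uncut chord.\<close>

lemma excess_le:
  fixes g :: "int \<Rightarrow> 'l"
  assumes k: "k = 2 * d + 1" "1 \<le> d" and per: "\<And>i. g (i + k) = g i"
  shows "excess k d g \<le> k - 3"
proof -
  define h where "h a = (\<Sum>i\<in>{a..<a + k}. of_bool (g i \<noteq> g (i + d)) :: int)" for a
  define c where "c a = (\<Sum>i\<in>{a..<a + k}. of_bool (g i \<noteq> g (i + 1)) :: int)" for a
  have win: "excess k d g = h a - c a" for a
    unfolding h_def c_def using per k by (intro excess_window) auto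
  have h_le: "h a \<le> k" for a
  proof -
    have "h a \<le> (\<Sum>i\<in>{a..<a + k}. 1)" unfolding h_def by (intro sum_mono) auto
    then show ?thesis using k by simp
  qed
  show ?thesis
  proof (cases "\<forall>i. g i = g (i + 1)")
    case True
    have "g (i + d) = g i" for i
      by (rule constant_on_interval[symmetric]) (use k in simp, use True in blast)
    moreover have "c 0 \<ge> 0" unfolding c_def by (intro sum_nonneg) simp
    ultimately show ?thesis using win[of 0] k by (simp add: h_def)
  next
    case False
    then obtain a where a: "g a \<noteq> g (a + 1)" by blast
    \<comment> \<open>A label that changes once along a period has to change back.\<close>
    have "\<exists>b. a < b \<and> b < a + k \<and> g b \<noteq> g (b + 1)"
    proof (rule ccontr)
      assume "\<not> ?thesis"
      then have no: "g i = g (i + 1)" if "a + 1 \<le> i" "i < a + k" for i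
        using that by force
      have "g (a + 1) = g (a + k)"
        by (rule constant_on_interval) (use k in simp, rule no)
      with a per show False by simp
    qed
    then obtain b where b: "a < b" "b < a + k" "g b \<noteq> g (b + 1)" by blast
    show ?thesis
    proof (cases "\<exists>e. a < e \<and> e < a + k \<and> e \<noteq> b \<and> g e \<noteq> g (e + 1)")
      case True
      then obtain e where e: "a < e" "e < a + k" "e \<noteq> b" "g e \<noteq> g (e + 1)" by blast
      have "(\<Sum>i\<in>{a, b, e}. of_bool (g i \<noteq> g (i + 1)) :: int) \<le> c a"
        unfolding c_def using b e by (intro sum_mono2) auto
      then have "3 \<le> c a" using a b e by simp
      then show ?thesis using win[of a] h_le[of a] by simp
    next
      case False
      have const: "g i = g j" if "a < i" "i \<le> j" "j \<le> a + k" "j \<le> b \<or> b < i" for i j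
      proof (rule constant_on_interval)
        fix l assume "i \<le> l" "l < j"
        then have "a < l" "l < a + k" "l \<noteq> b" using that by auto
        with False show "g l = g (l + 1)" by blast
      qed (use that in simp)
      \<comment> \<open>The intervals from \<open>a + 1\<close> to \<open>b\<close> and from
        \<open>b + 1\<close> to \<open>a + k\<close> have \<open>2 * d + 1\<close> elements
        together, so one of them contains its first element shifted by \<open>d\<close>.\<close>
      have "\<exists>i. a \<le> i \<and> i < a + k \<and> g i = g (i + d)"
      proof (cases "b - a \<ge> d + 1")
        case True
        then have "g (a + 1) = g (a + 1 + d)" using k b by (intro const) auto
        then show ?thesis using k by (intro exI[of _ "a + 1"]) auto
      next
        case False
        then have "g (b + 1) = g (b + 1 + d)" using k b by (intro const) auto
        then show ?thesis using k b False by (intro exI[of _ "b + 1"]) auto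
      qed
      then obtain i where i: "i \<in> {a..<a + k}" "g i = g (i + d)" by auto
      have "h a = (\<Sum>j\<in>{a..<a + k} - {i}. of_bool (g j \<noteq> g (j + d)))"
        unfolding h_def using i by (subst sum.remove[of _ i]) auto
      also have "\<dots> \<le> (\<Sum>j\<in>{a..<a + k} - {i}. 1)" by (intro sum_mono) auto
      also have "\<dots> = k - 1" using i k by simp
      finally have "h a \<le> k - 1" .
      moreover have "(\<Sum>i\<in>{a, b}. of_bool (g i \<noteq> g (i + 1)) :: int) \<le> c a"
        unfolding c_def using b by (intro sum_mono2) auto
      then have "2 \<le> c a" using a b by simp
      ultimately show ?thesis using win[of a] by simp
    qed
  qed
qed

subsection \<open>Functionals constant on tight decompositions\<close>

text \<open>Three blocks and singletons elsewhere; the label \<open>Inl z\<close> makes each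
  remaining vertex a block of its own. Moving a vertex between blocks becomes a function
  update.\<close>

definition block_label :: "'v set \<Rightarrow> 'v set \<Rightarrow> 'v set \<Rightarrow> 'v \<Rightarrow> 'v + nat" where
  "block_label M B C z =
     (if z \<in> M then Inr 0 else if z \<in> B then Inr 1 else if z \<in> C then Inr 2 else Inl z)"

text \<open>
  Positions on the cycle and indices of terminals are unrolled to the integers, so that cyclic arcs
  become images of integer intervals: \<open>w\<close> has period \<open>m\<close>, and \<open>q\<close> maps the index of a terminal to its
  position.
\<close>

locale cyclic_terminals =
  fixes V :: "'v::finite set" and E :: "'v set set" and w :: "int \<Rightarrow> 'v" and q :: "int \<Rightarrow> int"
    and m k d :: int
  assumes conn: "connected_graph V E"
    and k_eq: "k = 2 * d + 1" and d_ge: "2 \<le> d"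
    and w_eq_iff: "w a = w b \<longleftrightarrow> m dvd a - b"
    and w_in: "w u \<in> V" and w_edge: "{w u, w (u + 1)} \<in> E"
    and q_mono: "strict_mono q" and q_period: "q (i + k) = q i + m"
begin

abbreviation v :: "int \<Rightarrow> 'v" where "v i \<equiv> w (q i)"

abbreviation arc :: "int \<Rightarrow> int \<Rightarrow> 'v set" where "arc a b \<equiv> w ` {a..b}"

definition linked :: "'v set \<Rightarrow> bool" where
  "linked S \<longleftrightarrow> S \<subseteq> V \<and> (S = {} \<or> connected_graph S (induced_edges E S))"

lemma simple: "simple_graph V E"
  using conn by (simp add: connected_graph_def)

lemma edge_in: "{a, b} \<in> E \<Longrightarrow> a \<in> V \<and> b \<in> V"
  using simple by (auto simp: simple_graph_def pairs_def)

lemma q_less_iff [simp]: "q i < q j \<longleftrightarrow> i < j"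
  using q_mono by (rule strict_mono_less)

lemma q_le_iff [simp]: "q i \<le> q j \<longleftrightarrow> i \<le> j"
  using q_mono by (rule strict_mono_less_eq)

lemma m_pos: "0 < m"
  using q_period[of 0] q_less_iff[of 0 k] k_eq d_ge by simp

lemma w_period: "w (u + m) = w u"
  by (simp add: w_eq_iff)

lemma w_inj: "w a = w b \<Longrightarrow> \<bar>a - b\<bar> < m \<Longrightarrow> a = b"
  using zdvd_imp_le[of m "\<bar>a - b\<bar>"] by (cases "a = b") (auto simp: w_eq_iff)

lemma v_period: "v (i + k) = v i"
  by (simp add: q_period w_period)

lemma q_period_mult: "q (i + k * s) = q i + m * s"
proof (induction s rule: int_induct[where k = 0])
  case (step1 s)
  then show ?case using q_period[of "i + k * s"] by (simp add: algebra_simps)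
next
  case (step2 s)
  then show ?case using q_period[of "i + k * (s - 1)"] by (simp add: algebra_simps)
qed simp

lemma v_period_mult: "v (i + k * s) = v i"
  by (simp add: q_period_mult w_eq_iff)

lemma v_distinct: "i < j \<Longrightarrow> j < i + k \<Longrightarrow> v i \<noteq> v j"
proof
  assume "i < j" "j < i + k" "v i = v j"
  then show False using w_inj[of "q i" "q j"] q_less_iff[of i j] q_less_iff[of j "i + k"]
    by (auto simp: q_period simp del: q_less_iff)
qed

lemma terminal_position:
  assumes "w u = v j"
  obtains l where "u = q l"
proof -
  from assms obtain s where "u - q j = m * s" by (auto simp: w_eq_iff)
  then have "u = q (j + k * s)" by (simp add: q_period_mult)
  then show ?thesis by (rule that)
qed

text \<open>All positions involved lie in one window of length \<open>m\<close>, on which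
  \<open>w\<close> is injective.\<close>

lemma arc_disjoint:
  assumes "b < c" "e < a + m"
  shows "arc a b \<inter> arc c e = {}"
proof -
  have False if "u \<in> {a..b}" "u' \<in> {c..e}" "w u = w u'" for u u'
    using w_inj[OF that(3)] that(1,2) assms by auto
  then show ?thesis by blast
qed

lemma notin_arc_after: "u < a \<Longrightarrow> b < u + m \<Longrightarrow> w u \<notin> arc a b"
  using arc_disjoint[of u a b u] by auto

lemma notin_arc_before: "b < u \<Longrightarrow> u < a + m \<Longrightarrow> w u \<notin> arc a b"
  using arc_disjoint[of b u u a] by auto

lemma arc_mono: "a \<le> a' \<Longrightarrow> b' \<le> b \<Longrightarrow> arc a' b' \<subseteq> arc a b"
  by (intro image_mono) auto

lemma insert_arc_first: "a \<le> b \<Longrightarrow> insert (w a) (arc (a + 1) b) = arc a b"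
  unfolding image_insert[symmetric] by (intro arg_cong[where f = "(`) w"]) auto

lemma insert_arc_last: "a \<le> b \<Longrightarrow> insert (w b) (arc a (b - 1)) = arc a b"
  unfolding image_insert[symmetric] by (intro arg_cong[where f = "(`) w"]) auto

lemma walk_arc: "walk E (map w [a..b])"
proof -
  have "{w (a + int n), w (1 + (a + int n))} \<in> E" for n
    using w_edge[of "a + int n"] by (simp add: add.commute)
  then show ?thesis by (auto simp: successively_conv_nth algebra_simps)
qed

lemma linked_walk: "walk E xs \<Longrightarrow> set xs \<subseteq> V \<Longrightarrow> linked (set xs)"
  using connected_graph_walk[OF simple] by (cases "xs = []") (auto simp: linked_def)

lemma linked_arc: "linked (arc a b)"
  using linked_walk[OF walk_arc[of a b]] w_in by auto

lemma linked_empty [simp]: "linked {}"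
  by (simp add: linked_def)

lemma connected_fibres_block_label:
  assumes l: "linked M" "linked B" "linked C" and dj: "M \<inter> B = {}" "M \<inter> C = {}" "B \<inter> C = {}"
  shows "connected_fibres V E (block_label M B C)"
  unfolding connected_fibres_def
proof
  fix z assume z: "z \<in> V"
  let ?F = "{u \<in> V. block_label M B C u = block_label M B C z}"
  have sing: "connected_graph {z} (induced_edges E {z})"
    using connected_graph_walk[OF simple, of "[z]"] by simp
  consider "z \<in> M" | "z \<in> B" | "z \<in> C" | "z \<notin> M \<union> B \<union> C" by blast
  then show "connected_graph ?F (induced_edges E ?F)"
  proof cases
    case 1
    then have "?F = M" using l by (auto simp: block_label_def linked_def split: if_splits)
    then show ?thesis using l 1 by (auto simp: linked_def)
  next
    case 2
    then have "?F = B" using l dj by (auto simp: block_label_def linked_def split: if_splits)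
    then show ?thesis using l 2 by (auto simp: linked_def)
  next
    case 3
    then have "?F = C" using l dj by (auto simp: block_label_def linked_def split: if_splits)
    then show ?thesis using l 3 by (auto simp: linked_def)
  next
    case 4
    then have "?F = {z}" using z by (auto simp: block_label_def split: if_splits)
    then show ?thesis using sing by simp
  qed
qed

section \<open>Positions between terminals, and walks from a vertex to the cycle\<close>

lemma q_diff_ge: "i \<le> j \<Longrightarrow> j - i \<le> q j - q i"
proof (induction j rule: int_ge_induct)
  case (step j)
  then show ?case using q_less_iff[of j "j + 1"] by linarith
qed simp

text \<open>Here \<open>i\<close> is the index of the first terminal at or after position
  \<open>u\<close>. It exists since a strictly increasing integer sequence is unbounded in both
  directions.\<close>

lemma index_exists: "\<exists>i. q (i - 1) < u \<and> u \<le> q i"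
proof -
  define a where "a = - (\<bar>u\<bar> + \<bar>q 0\<bar> + 1)"
  define b where "b = \<bar>u\<bar> + \<bar>q 0\<bar>"
  have "a \<le> 0" "0 \<le> b" by (simp_all add: a_def b_def)
  then have "- a \<le> q 0 - q a" "b \<le> q b - q 0"
    using q_diff_ge[of a 0] q_diff_ge[of 0 b] by simp_all
  then have a: "q a < u" and "u \<le> q b" using a_def b_def by linarith+
  moreover have "a \<le> b" by (simp add: a_def b_def)
  then have "u \<le> q b \<longrightarrow> ?thesis"
  proof (induction b rule: int_ge_induct)
    case base
    then show ?case using a by simp
  next
    case (step b)
    then show ?case by (cases "u \<le> q b") (auto intro: exI[of _ "b + 1"])
  qed
  ultimately show ?thesis by blast
qed

definition approach :: "'v \<Rightarrow> 'v list \<Rightarrow> int \<Rightarrow> bool" where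
  "approach x X \<zeta> \<longleftrightarrow> walk E (X @ [w \<zeta>]) \<and> hd (X @ [w \<zeta>]) = x \<and> set X \<inter> range w = {} \<and>
     x \<notin> set (tl (X @ [w \<zeta>]))"

lemma approach_cycle: "approach (w u) [] u"
  by (simp add: approach_def)

lemma approach_exists:
  assumes "x \<in> V"
  shows "\<exists>X \<zeta>. approach x X \<zeta>"
proof -
  have "(x, w 0) \<in> {(p, q). {p, q} \<in> E}\<^sup>*"
    using conn assms w_in by (auto simp: connected_graph_def)
  then show ?thesis
  proof (induction rule: converse_rtrancl_induct)
    case base
    then show ?case using approach_cycle by blast
  next
    case (step x x')
    then obtain X \<zeta> where X: "approach x' X \<zeta>" by blast
    have e: "{x, x'} \<in> E" using step by simp
    consider "x \<in> range w" | "x \<notin> range w" "x \<notin> set X" | "x \<notin> range w" "x \<in> set X" by blast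
    then show ?case
    proof cases
      case 1
      then show ?thesis using approach_cycle by blast
    next
      case 2
      then have "approach x (x # X) \<zeta>" using X e by (auto simp: approach_def successively_Cons)
      then show ?thesis by blast
    next
      case 3
      \<comment> \<open>Cutting at the last occurrence of \<open>x\<close> keeps \<open>x\<close>
        from recurring.\<close>
      then obtain as bs where s: "X = as @ x # bs" "x \<notin> set bs" by (meson split_list_last)
      then have "approach x (x # bs) \<zeta>"
        using X 3 by (auto simp: approach_def successively_append_iff)
      then show ?thesis by blast
    qed
  qed
qed

lemma approach_shift: "approach x X \<zeta> \<Longrightarrow> m dvd \<zeta> - \<zeta>' \<Longrightarrow> approach x X \<zeta>'"
  using w_eq_iff[of \<zeta> \<zeta>'] by (simp add: approach_def)

text \<open>The landing position is determined modulo \<open>m\<close> only, so it can be placed at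
  most one turn before \<open>u\<close>.\<close>

lemma approach_normalised:
  assumes "x \<in> V"
  obtains X \<zeta> where "approach x X \<zeta>" "\<zeta> \<le> u" "u < \<zeta> + m"
proof -
  obtain X \<zeta> where X: "approach x X \<zeta>" using approach_exists[OF assms] by blast
  have "m dvd \<zeta> - (u - (u - \<zeta>) mod m)"
    using dvd_minus_mod[of m "u - \<zeta>"] by (simp add: dvd_diff_commute algebra_simps)
  from approach_shift[OF X this] show ?thesis
    using m_pos pos_mod_bound[of m "u - \<zeta>"] pos_mod_sign[of m "u - \<zeta>"]
    by (intro that[of X "u - (u - \<zeta>) mod m"]) auto
qed

text \<open>Follow \<open>X\<close> to the cycle, the cycle forward from \<open>\<zeta>\<close> to
  \<open>\<eta>\<close>, then \<open>Y\<close> backwards. As \<open>x\<close> and \<open>y\<close>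
  occur at the ends only, the inner vertices stay connected with either, both or none of
  them.\<close>

lemma connecting_walk:
  assumes X: "approach x X \<zeta>" and Y: "approach y Y \<eta>" and ord: "\<zeta> \<le> \<eta>" "\<eta> < \<zeta> + m"
    and xy: "x \<noteq> y" "x \<notin> set Y" "y \<notin> set X"
  obtains ps where "walk E (x # ps @ [y])" "x \<notin> set ps" "y \<notin> set ps"
    "insert x (insert y (set ps)) = set X \<union> arc \<zeta> \<eta> \<union> set Y"
proof -
  define A where "A = map w [\<zeta>..\<eta>]"
  define W where "W = X @ A @ rev Y"
  have A: "A = w \<zeta> # map w [\<zeta> + 1..\<eta>]" "A = map w [\<zeta>..\<eta> - 1] @ [w \<eta>]"
    unfolding A_def by (simp only: upto_rec1[OF ord(1)] list.map)
      (simp only: upto_rec2[OF ord(1)] map_append list.map)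
  have hdA: "hd A = w \<zeta>" and A0: "A \<noteq> []" using A(1) by simp_all
  have lastA: "last A = w \<eta>" using A(2) by simp
  have "walk E (rev Y)"
    using Y by (auto simp: approach_def successively_append_iff insert_commute)
  moreover have "Y \<noteq> [] \<Longrightarrow> {w \<eta>, last Y} \<in> E"
    using Y by (auto simp: approach_def successively_append_iff insert_commute)
  ultimately have "walk E (A @ rev Y)"
    using walk_arc[of \<zeta> \<eta>] lastA by (auto simp: successively_append_iff A_def hd_rev)
  then have W: "walk E W"
    using X hdA A0 by (auto simp: W_def approach_def successively_append_iff)
  have "hd W = x" using X hdA A0 by (cases X) (auto simp: W_def approach_def)
  moreover have "last W = y" using Y lastA A0 by (cases Y) (auto simp: W_def approach_def)
  moreover have "W \<noteq> []" using A0 by (simp add: W_def)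
  ultimately obtain ps where ps: "W = x # ps @ [y]"
    using xy by (metis append_butlast_last_id last_ConsL list.collapse last_ConsR)
  have xA: "x \<notin> set (tl W)"
  proof (cases X)
    case Nil
    then have "x = w \<zeta>" using X by (simp add: approach_def)
    moreover have "w \<zeta> \<notin> arc (\<zeta> + 1) \<eta>" using ord by (intro notin_arc_after) auto
    ultimately show ?thesis using Nil xy A(1) by (simp add: W_def)
  next
    case (Cons a X')
    then show ?thesis using X xy by (auto simp: approach_def W_def A_def)
  qed
  have yA: "y \<notin> set (butlast W)"
  proof (cases Y)
    case Nil
    then have "y = w \<eta>" using Y by (simp add: approach_def)
    moreover have "w \<eta> \<notin> arc \<zeta> (\<eta> - 1)" using ord by (intro notin_arc_before) auto
    ultimately show ?thesis using Nil xy A(2) by (simp add: W_def butlast_append)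
  next
    case (Cons a Y')
    then show ?thesis using Y xy by (auto simp: approach_def W_def A_def butlast_append)
  qed
  show ?thesis
  proof (rule that[of ps])
    have "set W = set X \<union> arc \<zeta> \<eta> \<union> set Y" by (simp add: W_def A_def Un_assoc)
    then show "insert x (insert y (set ps)) = set X \<union> arc \<zeta> \<eta> \<union> set Y" by (simp add: ps)
  qed (use W xA yA in \<open>auto simp: ps butlast_append\<close>)
qed

end

section \<open>Weights that are constant on tight decompositions\<close>

locale tight_weights = cyclic_terminals V E w q m k d
  for V :: "'v::finite set" and E :: "'v set set" and w :: "int \<Rightarrow> 'v" and q :: "int \<Rightarrow> int"
    and m k d :: int +
  fixes \<alpha> :: "'v set \<Rightarrow> real" and \<kappa> :: real
  assumes cut_const: "connected_fibres V E g \<Longrightarrow> excess k d (\<lambda>i. g (v i)) = k - 3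
      \<Longrightarrow> cut_weight V \<alpha> (g :: 'v \<Rightarrow> 'v + nat) = \<kappa>"
begin

lemma cut_weight_three_intervals:
  assumes "linked M" "linked B" "linked C" "M \<inter> B = {}" "M \<inter> C = {}" "B \<inter> C = {}"
    and "i\<^sub>1 < i\<^sub>2" "i\<^sub>2 < i\<^sub>3" "i\<^sub>3 < i\<^sub>1 + k"
    and "i\<^sub>2 - i\<^sub>1 \<le> d" "i\<^sub>3 - i\<^sub>2 \<le> d" "i\<^sub>1 + k - i\<^sub>3 \<le> d"
    and "\<And>i. i\<^sub>1 \<le> i \<Longrightarrow> i < i\<^sub>2 \<Longrightarrow> block_label M B C (v i) = l\<^sub>1"
      "\<And>i. i\<^sub>2 \<le> i \<Longrightarrow> i < i\<^sub>3 \<Longrightarrow> block_label M B C (v i) = l\<^sub>2"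
      "\<And>i. i\<^sub>3 \<le> i \<Longrightarrow> i < i\<^sub>1 + k \<Longrightarrow> block_label M B C (v i) = l\<^sub>3"
    and "l\<^sub>1 \<noteq> l\<^sub>2" "l\<^sub>1 \<noteq> l\<^sub>3" "l\<^sub>2 \<noteq> l\<^sub>3"
  shows "cut_weight V \<alpha> (block_label M B C) = \<kappa>"
  by (intro cut_const connected_fibres_block_label assms
      excess_three_intervals[of k d _ i\<^sub>1 i\<^sub>2 i\<^sub>3 l\<^sub>1 l\<^sub>2 l\<^sub>3] k_eq) (simp add: v_period)

lemma cut_weight_two_intervals:
  assumes "linked M" "linked B" "linked C" "M \<inter> B = {}" "M \<inter> C = {}" "B \<inter> C = {}"
    and "\<And>i. i\<^sub>1 \<le> i \<Longrightarrow> i < i\<^sub>1 + d \<Longrightarrow> block_label M B C (v i) = l\<^sub>1"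
      "\<And>i. i\<^sub>1 + d \<le> i \<Longrightarrow> i < i\<^sub>1 + k \<Longrightarrow> block_label M B C (v i) = l\<^sub>2"
    and "l\<^sub>1 \<noteq> l\<^sub>2"
  shows "cut_weight V \<alpha> (block_label M B C) = \<kappa>"
  by (intro cut_const connected_fibres_block_label assms
      excess_two_intervals[of k d _ i\<^sub>1 l\<^sub>1 l\<^sub>2] k_eq) (use d_ge v_period in simp_all)

text \<open>Both vertices start in the block of \<open>M\<close>; \<open>x\<close> may leave for
  \<open>C\<close> or become a singleton, \<open>y\<close> may leave for \<open>B\<close> or become
  a singleton. The target labels \<open>l\<close> and \<open>r\<close> always differ, so
  \<open>cut_weight_four_labellings\<close> applies.\<close>

lemma weight_zero_if_four_tight:
  assumes xy: "x \<in> V" "y \<in> V" "x \<noteq> y" "x \<notin> M \<union> B \<union> C" "y \<notin> M \<union> B \<union> C"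
    and dj: "M \<inter> B = {}" "M \<inter> C = {}" "B \<inter> C = {}"
    and B': "B' = B \<or> B' = insert y B" and C': "C' = C \<or> C' = insert x C"
    and "cut_weight V \<alpha> (block_label (insert x (insert y M)) B C) = \<kappa>"
      "cut_weight V \<alpha> (block_label (insert y M) B C') = \<kappa>"
      "cut_weight V \<alpha> (block_label (insert x M) B' C) = \<kappa>"
      "cut_weight V \<alpha> (block_label M B' C') = \<kappa>"
  shows "\<alpha> {x, y} = 0"
proof -
  define l :: "'v + nat" where "l = (if C' = C then Inl x else Inr 2)"
  define r :: "'v + nat" where "r = (if B' = B then Inl y else Inr 1)"
  let ?h = "block_label M B C"
  have 1: "?h(x := Inr 0, y := Inr 0) = block_label (insert x (insert y M)) B C"
    by (rule ext) (auto simp: block_label_def)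
  have 2: "?h(x := l, y := Inr 0) = block_label (insert y M) B C'"
    using xy C' by (intro ext) (auto simp: block_label_def l_def)
  have 3: "?h(x := Inr 0, y := r) = block_label (insert x M) B' C"
    using xy B' by (intro ext) (auto simp: block_label_def r_def)
  have 4: "?h(x := l, y := r) = block_label M B' C'"
    using xy B' C' by (intro ext) (auto simp: block_label_def l_def r_def)
  show ?thesis
    by (rule cut_weight_four_labellings[of V x y l "Inr 0" r \<alpha> ?h \<kappa>])
      (unfold 1 2 3 4, use xy assms(11-) in \<open>simp_all add: l_def r_def\<close>)
qed

lemma linked_walk_parts:
  assumes "walk E (x # ps @ [y])"
  shows "linked (set ps)" "linked (insert x (set ps))" "linked (insert y (set ps))"
    "linked (insert x (insert y (set ps)))" "x \<in> V" "y \<in> V" "set ps \<subseteq> V"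
proof -
  have all: "set (x # ps @ [y]) \<subseteq> V"
  proof
    fix z assume "z \<in> set (x # ps @ [y])"
    then obtain n where n: "n < length (x # ps @ [y])" "(x # ps @ [y]) ! n = z"
      by (meson in_set_conv_nth)
    show "z \<in> V"
    proof (cases n)
      case 0
      then show ?thesis using assms n edge_in[of x "hd (ps @ [y])"] by (auto simp: successively_Cons)
    next
      case (Suc n')
      then have "{(x # ps @ [y]) ! n', z} \<in> E"
        using assms n unfolding successively_conv_nth by blast
      then show ?thesis using edge_in by blast
    qed
  qed
  have "walk E (ps @ [y])" using assms by (auto simp: successively_Cons)
  moreover have "walk E (x # ps)"
    using assms successively_append_iff[of _ "x # ps" "[y]"] by simp
  moreover have "walk E ps"
    using \<open>walk E (ps @ [y])\<close> by (simp add: successively_append_iff)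
  ultimately have "walk E ps" "walk E (x # ps)" "walk E (ps @ [y])" by simp_all
  from this[THEN linked_walk] linked_walk[OF assms] all
  show "linked (set ps)" "linked (insert x (set ps))" "linked (insert y (set ps))"
    "linked (insert x (insert y (set ps)))" "x \<in> V" "y \<in> V" "set ps \<subseteq> V" by auto
qed

section \<open>Pairs of weight zero\<close>

lemma in_arc: "a \<le> q j \<Longrightarrow> q j \<le> b \<Longrightarrow> v j \<in> arc a b"
  by simp

text \<open>The hypotheses force \<open>x\<close> and \<open>y\<close> to be non-terminals, so their
  leaving as singletons does not affect the terminals. The walk holds \<open>t\<close> terminals,
  \<open>B\<close> the next \<open>d\<close>, and \<open>C\<close> the remaining
  \<open>d + 1 - t\<close>; for \<open>t = 0\<close> or \<open>t = d + 1\<close> only two intervals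
  are left, of sizes \<open>d\<close> and \<open>d + 1\<close>.\<close>

lemma weight_zero_nonterminals:
  assumes walk: "walk E (x # ps @ [y])" and xy: "x \<noteq> y" "x \<notin> set ps" "y \<notin> set ps"
    and t: "0 \<le> t" "t \<le> d + 1"
    and inside: "\<And>l. i \<le> l \<Longrightarrow> l < i + t \<Longrightarrow> v l \<in> set ps"
    and outside: "set (x # ps @ [y]) \<inter> arc (q (i + t)) (q (i + k - 1)) = {}"
  shows "\<alpha> {x, y} = 0"
proof -
  note parts = linked_walk_parts[OF walk]
  have out: "insert x (insert y (set ps)) \<inter> arc (q (i + t)) (q (i + k - 1)) = {}"
    using outside by auto
  define B where "B = arc (q (i + t)) (q (i + t + d - 1))"
  define C where "C = arc (q (i + t + d)) (q (i + k - 1))"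
  have sub: "B \<subseteq> arc (q (i + t)) (q (i + k - 1))" "C \<subseteq> arc (q (i + t)) (q (i + k - 1))"
    unfolding B_def C_def by (rule arc_mono; use d_ge k_eq t in simp)+
  have dBC: "B \<inter> C = {}"
    unfolding B_def C_def
    using q_less_iff[of "i + k - 1" "i + t + k"] t d_ge
    by (intro arc_disjoint) (auto simp: q_period)
  have inB: "v l \<in> B" if "i + t \<le> l" "l < i + t + d" for l
    unfolding B_def using that by (intro in_arc) auto
  have inC: "v l \<in> C" if "i + t + d \<le> l" "l < i + k" for l
    unfolding C_def using that by (intro in_arc) auto
  have lB: "linked B" and lC: "linked C" unfolding B_def C_def by (rule linked_arc)+
  have tight: "cut_weight V \<alpha> (block_label M B C) = \<kappa>"
    if M: "linked M" "set ps \<subseteq> M" "M \<subseteq> insert x (insert y (set ps))" for M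
  proof -
    have dM: "M \<inter> B = {}" "M \<inter> C = {}" using M(3) out sub by fast+
    have labM: "block_label M B C (v l) = Inr 0" if "i \<le> l" "l < i + t" for l
      using inside[OF that] M by (auto simp: block_label_def)
    have labB: "block_label M B C (v l) = Inr 1" if "i + t \<le> l" "l < i + t + d" for l
      using inB[OF that] dM by (auto simp: block_label_def)
    have labC: "block_label M B C (v l) = Inr 2" if "i + t + d \<le> l" "l < i + k" for l
      using inC[OF that] dM dBC by (auto simp: block_label_def)
    consider "t = 0" | "t = d + 1" | "1 \<le> t" "t \<le> d" using t by linarith
    then show ?thesis
    proof cases
      case 1
      show ?thesis
        by (rule cut_weight_two_intervals[of _ _ _ i "Inr 1" "Inr 2"])
          (use M lB lC dM dBC labB labC 1 in auto)
    next
      case 2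
      have "block_label M B C (v l) = Inr 0" if "i + t + d \<le> l" "l < i + t + k" for l
        using that 2 k_eq labM[of "l - k"] v_period[of "l - k"] by simp
      then show ?thesis
        by (intro cut_weight_two_intervals[of _ _ _ "i + t" "Inr 1" "Inr 0"])
          (use M lB lC dM dBC labB in auto)
    next
      case 3
      then show ?thesis
        by (intro cut_weight_three_intervals[of _ _ _ i "i + t" "i + t + d" "Inr 0" "Inr 1" "Inr 2"])
          (use M lB lC dM dBC labM labB labC k_eq d_ge in auto)
    qed
  qed
  show ?thesis
  proof (rule weight_zero_if_four_tight[of x y "set ps" B C B C])
    show "x \<notin> set ps \<union> B \<union> C" "y \<notin> set ps \<union> B \<union> C" "set ps \<inter> B = {}" "set ps \<inter> C = {}"
      using out sub xy by fast+
  qed (use parts xy dBC tight in auto)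
qed

text \<open>
  If \<open>t = 1\<close> or \<open>t = d + 1\<close>, the terminal \<open>v j\<close> leaves the block of \<open>x\<close> as a singleton. Otherwise it joins
  the next block; three intervals of sizes \<open>t\<close>, \<open>d - 1\<close>, \<open>d + 2 - t\<close> then become \<open>t - 1\<close>, \<open>d\<close>, \<open>d + 2 - t\<close>.
\<close>

lemma weight_zero_terminal_forward:
  assumes walk: "walk E (x # ps @ [v j])" and xy: "x \<noteq> v j" "x \<notin> set ps" "v j \<notin> set ps"
    and t: "1 \<le> t" "t \<le> d + 1"
    and inside: "\<And>l. j - t < l \<Longrightarrow> l < j \<Longrightarrow> v l \<in> set ps"
    and outside: "set (x # ps) \<inter> arc (q j) (q (j - t) + m) = {}"
  shows "\<alpha> {x, v j} = 0"
proof -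
  note parts = linked_walk_parts[OF walk]
  \<comment> \<open>\<open>e\<close> is the number of terminals of \<open>B\<close> together with
    \<open>v j\<close>. If \<open>v j\<close> becomes a singleton, \<open>B\<close> alone must have
    \<open>d\<close> terminals; if \<open>v j\<close> joins \<open>B\<close>, the union
    must.\<close>
  define e where "e = (if t = 1 \<or> t = d + 1 then d + 1 else d)"
  have e: "2 \<le> e" "e \<le> d + 1" using d_ge by (auto simp: e_def)
  have qt: "q (j - t) + m = q (j - t + k)" by (simp add: q_period)
  have out: "insert x (set ps) \<inter> arc (q j) (q (j - t + k)) = {}"
    using outside by (auto simp: qt)
  \<comment> \<open>Starting at \<open>q j + 1\<close> instead of the next terminal makes
    \<open>B\<close> an arc that \<open>v j\<close> extends. For \<open>t = d + 1\<close> the arc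
    \<open>C\<close> is empty.\<close>
  define B where "B = arc (q j + 1) (q (j + e - 1))"
  define C where "C = arc (q (j + e)) (q (j - t + k))"
  have sub: "B \<subseteq> arc (q j) (q (j - t + k))" "C \<subseteq> arc (q j) (q (j - t + k))"
    unfolding B_def C_def by (rule arc_mono; use d_ge k_eq t e in simp)+
  have B': "insert (v j) B = arc (q j) (q (j + e - 1))"
    unfolding B_def using e by (intro insert_arc_first) simp
  have dBC: "insert (v j) B \<inter> C = {}"
    unfolding B' C_def using q_less_iff[of "j - t + k" "j + k"] t
    by (intro arc_disjoint) (auto simp: q_period)
  have yB: "v j \<notin> B"
  proof -
    have "q (j + e - 1) < q (j + k)" using e k_eq d_ge by simp
    then show ?thesis unfolding B_def by (intro notin_arc_after) (auto simp: q_period)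
  qed
  have inB: "v l \<in> B" if "j < l" "l < j + e" for l
    unfolding B_def using that q_less_iff[of j l] by (intro in_arc) (auto simp del: q_less_iff)
  have inC: "v l \<in> C" if "j + e \<le> l" "l \<le> j - t + k" for l
    unfolding C_def using that by (intro in_arc) auto
  have lB: "linked B" and lB': "linked (insert (v j) B)" and lC: "linked C"
    unfolding B' unfolding B_def C_def by (rule linked_arc)+
  define B'' where "B'' = (if t = 1 \<or> t = d + 1 then B else insert (v j) B)"
  have tight: "cut_weight V \<alpha> (block_label (insert (v j) M) B C) = \<kappa> \<and>
      cut_weight V \<alpha> (block_label M B'' C) = \<kappa>"
    if M: "linked M" "linked (insert (v j) M)" "set ps \<subseteq> M" "M \<subseteq> insert x (set ps)" for M
  proof -
    have yM: "v j \<notin> M" using M xy by auto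
    have dM: "M \<inter> insert (v j) B = {}" "insert (v j) M \<inter> B = {}" "insert (v j) M \<inter> C = {}" "M \<inter> C = {}"
      using M(4) out sub yM yB dBC by fast+
    have labM: "block_label M D F (v l) = Inr 0" if "j - t < l" "l < j" for l D F
      using inside[OF that] M by (auto simp: block_label_def)
    have labM': "block_label (insert (v j) M) D F (v l) = Inr 0" if "j - t < l" "l \<le> j" for l D F
      using inside[of l] that M by (cases "l = j") (auto simp: block_label_def)
    have labB: "block_label M B C (v l) = Inr 1" "block_label (insert (v j) M) B C (v l) = Inr 1"
      "block_label M (insert (v j) B) C (v l) = Inr 1" if "j < l" "l < j + e" for l
      using inB[OF that] dM by (auto simp: block_label_def)
    have labC: "block_label M B C (v l) = Inr 2" "block_label (insert (v j) M) B C (v l) = Inr 2"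
      "block_label M (insert (v j) B) C (v l) = Inr 2" if "j + e \<le> l" "l \<le> j - t + k" for l
      using inC[OF that] dM dBC by (auto simp: block_label_def)
    have labj: "block_label M (insert (v j) B) C (v j) = Inr 1" "block_label M B C (v j) = Inl (v j)"
      using yM yB dBC by (auto simp: block_label_def)
    consider "t = 1" | "t = d + 1" | "2 \<le> t" "t \<le> d" using t by linarith
    then show ?thesis
    proof cases
      case 1
      then have e1: "e = d + 1" "B'' = B" by (auto simp: e_def B''_def)
      have "block_label (insert (v j) M) B C (v l) = Inr 0" "block_label M B C (v l) = Inl (v j)"
        if "j \<le> l" "l < j + 1" for l
      proof -
        from that have "l = j" by simp
        then show "block_label (insert (v j) M) B C (v l) = Inr 0" "block_label M B C (v l) = Inl (v j)"
          using labM'[of j] labj t by simp_all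
      qed
      note lab = this labB(1,2)[unfolded e1] labC(1,2)[unfolded e1 1]
      have "cut_weight V \<alpha> (block_label (insert (v j) M) B C) = \<kappa>"
        by (rule cut_weight_three_intervals[of _ _ _ j "j + 1" "j + d + 1" "Inr 0" "Inr 1" "Inr 2"])
          (rule M lB lC dM | (rule lab; use k_eq in linarith) | use dBC k_eq d_ge 1 in force)+
      moreover have "cut_weight V \<alpha> (block_label M B C) = \<kappa>"
        by (rule cut_weight_three_intervals[of _ _ _ j "j + 1" "j + d + 1" "Inl (v j)" "Inr 1" "Inr 2"])
          (rule M lB lC dM | (rule lab; use k_eq in linarith) | use dM dBC k_eq d_ge 1 in force)+
      ultimately show ?thesis by (simp add: e1)
    next
      case 2
      then have e1: "e = d + 1" "B'' = B" by (auto simp: e_def B''_def)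
      have labj': "block_label M B C (v l) = Inl (v j)" if "j \<le> l" "l < j + 1" for l
        using that labj by (simp add: antisym)
      have labM2: "block_label M B C (v l) = Inr 0" if "j + 1 + d \<le> l" "l < j + k" for l
        using labM[of "l - k" B C] v_period[of "l - k"] that 2 k_eq by simp
      have labM2': "block_label (insert (v j) M) B C (v l) = Inr 0"
        if "j + 1 + d \<le> l" "l < j + 1 + k" for l
        using labM'[of "l - k" B C] v_period[of "l - k"] that 2 k_eq by simp
      note lab = labB(1,2)[unfolded e1] labj' labM2 labM2'
      have "cut_weight V \<alpha> (block_label (insert (v j) M) B C) = \<kappa>"
        by (rule cut_weight_two_intervals[of _ _ _ "j + 1" "Inr 1" "Inr 0"])
          (rule M lB lC dM | (rule lab; use k_eq in linarith) | use dBC in force)+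
      moreover have "cut_weight V \<alpha> (block_label M B C) = \<kappa>"
        by (rule cut_weight_three_intervals[of _ _ _ j "j + 1" "j + 1 + d" "Inl (v j)" "Inr 1" "Inr 0"])
          (rule M lB lC dM | (rule lab; use k_eq in linarith) | use dM dBC k_eq d_ge 2 in force)+
      ultimately show ?thesis by (simp add: e1)
    next
      case 3
      then have e1: "e = d" "B'' = insert (v j) B" by (auto simp: e_def B''_def)
      have labj': "block_label M (insert (v j) B) C (v l) = Inr 1" if "j \<le> l" "l < j + d" for l
        using labj labB(3)[of l] that by (cases "l = j") (auto simp: e1)
      note lab = labM labM' labB(2)[unfolded e1] labC(2,3)[unfolded e1] labj'
      have "cut_weight V \<alpha> (block_label (insert (v j) M) B C) = \<kappa>"
        by (rule cut_weight_three_intervals[of _ _ _ "j - t + 1" "j + 1" "j + d" "Inr 0" "Inr 1" "Inr 2"])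
          (rule M lB lC dM | (rule lab; linarith) | use dBC k_eq d_ge 3 in force)+
      moreover have "cut_weight V \<alpha> (block_label M (insert (v j) B) C) = \<kappa>"
        by (rule cut_weight_three_intervals[of _ _ _ "j - t + 1" j "j + d" "Inr 0" "Inr 1" "Inr 2"])
          (rule M lB' lC dM dBC | (rule lab; linarith) | use k_eq d_ge 3 in force)+
      ultimately show ?thesis by (simp add: e1)
    qed
  qed
  show ?thesis
  proof (rule weight_zero_if_four_tight[of x "v j" "set ps" B C B'' C])
    show "x \<notin> set ps \<union> B \<union> C" "v j \<notin> set ps \<union> B \<union> C" "set ps \<inter> B = {}" "set ps \<inter> C = {}"
      using out sub xy yB dBC by fast+
    show "cut_weight V \<alpha> (block_label (insert x (insert (v j) (set ps))) B C) = \<kappa>"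
      using tight[of "insert x (set ps)"] parts by (auto simp: insert_commute)
    show "cut_weight V \<alpha> (block_label (insert x (set ps)) B'' C) = \<kappa>"
      using tight[of "insert x (set ps)"] parts by (auto simp: insert_commute)
    show "cut_weight V \<alpha> (block_label (insert (v j) (set ps)) B C) = \<kappa>"
      "cut_weight V \<alpha> (block_label (set ps) B'' C) = \<kappa>"
      using tight[of "set ps"] parts by auto
  qed (use parts xy dBC in \<open>auto simp: B''_def\<close>)
qed

text \<open>\<open>v i\<close> may move back into \<open>C\<close> and \<open>v (i + n)\<close>
  forward into \<open>B\<close>. The interval sizes of \<open>M\<close>, \<open>B\<close>,
  \<open>C\<close> are \<open>n + 1\<close>, \<open>d + 1 - n\<close>, \<open>d - 1\<close> at first
  and \<open>n - 1\<close>, \<open>d + 2 - n\<close>, \<open>d\<close> after both moves. The bounds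
  on \<open>n\<close> keep all sizes between \<open>1\<close> and \<open>d\<close>.\<close>

lemma weight_zero_terminals:
  assumes n: "2 \<le> n" "n \<le> d - 1"
  shows "\<alpha> {v i, v (i + n)} = 0"
proof -
  \<comment> \<open>The arcs reach up to the neighbours of \<open>v i\<close> and
    \<open>v (i + n)\<close> on the cycle, so that these two can be attached on either side.\<close>
  define M where "M = arc (q i + 1) (q (i + n) - 1)"
  define B where "B = arc (q (i + n) + 1) (q (i + d + 1))"
  define C where "C = arc (q (i + d + 2)) (q (i + k) - 1)"
  let ?x = "v i" and ?y = "v (i + n)"
  have lt: "q i < q (i + 1)" "q (i + 1) < q (i + n)" "q (i + n) < q (i + d + 1)" "q (i + d + 1) < q (i + d + 2)"
    "q (i + d + 2) < q (i + k)" "q (i + k) = q i + m"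
    using n k_eq d_ge q_period[of i] q_less_iff[of "i + d + 2" "i + k"] by auto
  have xM: "insert ?x M = arc (q i) (q (i + n) - 1)"
    unfolding M_def using lt by (intro insert_arc_first) linarith
  have yM: "insert ?y M = arc (q i + 1) (q (i + n))"
    unfolding M_def using lt by (intro insert_arc_last) linarith
  have xyM: "insert ?x (insert ?y M) = arc (q i) (q (i + n))"
    unfolding yM using lt by (intro insert_arc_first) linarith
  have yB: "insert ?y B = arc (q (i + n)) (q (i + d + 1))"
    unfolding B_def using lt by (intro insert_arc_first) linarith
  have xC: "insert ?x C = arc (q (i + d + 2)) (q (i + k))"
    unfolding C_def v_period[of i, symmetric] using lt by (intro insert_arc_last) linarith
  have links: "linked M" "linked (insert ?x M)" "linked (insert ?y M)" "linked (insert ?x (insert ?y M))"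
     "linked B" "linked (insert ?y B)" "linked C" "linked (insert ?x C)"
    unfolding xyM unfolding xM yM yB xC unfolding M_def B_def C_def by (rule linked_arc)+
  have dj: "insert ?x (insert ?y M) \<inter> B = {}" "insert ?x (insert ?y M) \<inter> C = {}"
    "insert ?y B \<inter> insert ?x C = {}" "insert ?x M \<inter> insert ?y B = {}" "insert ?y M \<inter> insert ?x C = {}"
    unfolding xyM unfolding xM yM yB xC unfolding M_def B_def C_def
    using lt by (intro arc_disjoint; linarith)+
  have xM': "?x \<notin> insert ?y M"
    unfolding yM by (rule notin_arc_after) (use lt in linarith)+
  have "?y \<notin> M"
    unfolding M_def by (rule notin_arc_before) (use lt in linarith)+
  have xy: "?x \<noteq> ?y" and "?x \<notin> M" using xM' by auto
  show ?thesis
  proof (rule weight_zero_if_four_tight[of ?x ?y M B C "insert ?y B" "insert ?x C"])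
    show "?x \<notin> M \<union> B \<union> C" "?y \<notin> M \<union> B \<union> C"
      using dj \<open>?x \<notin> M\<close> \<open>?y \<notin> M\<close> by blast+
  next
    have in_M: "v l \<in> M" if "i < l" "l < i + n" for l
      using that q_less_iff[of i l] q_less_iff[of l "i + n"] unfolding M_def
      by (intro in_arc) (auto simp del: q_less_iff)
    have in_B: "v l \<in> B" if "i + n < l" "l < i + d + 2" for l
      using that q_less_iff[of "i + n" l] unfolding B_def
      by (intro in_arc) (auto simp del: q_less_iff)
    have in_C: "v l \<in> C" if "i + d + 2 \<le> l" "l < i + k" for l
      using that q_less_iff[of l "i + k"] unfolding C_def
      by (intro in_arc) (auto simp del: q_less_iff)
    have in_C': "v l \<in> insert ?x C" if "i + d + 2 \<le> l" "l < i + 1 + k" for l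
      using that in_C[of l] v_period[of i] by (cases "l = i + k") auto
    show "cut_weight V \<alpha> (block_label (insert ?x (insert ?y M)) B C) = \<kappa>"
    proof (rule cut_weight_three_intervals[of _ _ _ i "i + n + 1" "i + d + 2" "Inr 0" "Inr 1" "Inr 2"])
      show "block_label (insert ?x (insert ?y M)) B C (v l) = Inr 0" if "i \<le> l" "l < i + n + 1" for l
        using that in_M[of l] by (cases "l = i"; cases "l = i + n") (auto simp: block_label_def)
      show "block_label (insert ?x (insert ?y M)) B C (v l) = Inr 1" if "i + n + 1 \<le> l" "l < i + d + 2" for l
        using that in_B[of l] dj by (auto simp: block_label_def)
      show "block_label (insert ?x (insert ?y M)) B C (v l) = Inr 2" if "i + d + 2 \<le> l" "l < i + k" for l
        using that in_C[of l] dj by (auto simp: block_label_def)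
    qed (use links dj n k_eq in auto)
    show "cut_weight V \<alpha> (block_label (insert ?y M) B (insert ?x C)) = \<kappa>"
    proof (rule cut_weight_three_intervals[of _ _ _ "i + 1" "i + n + 1" "i + d + 2" "Inr 0" "Inr 1" "Inr 2"])
      show "block_label (insert ?y M) B (insert ?x C) (v l) = Inr 0" if "i + 1 \<le> l" "l < i + n + 1" for l
        using that in_M[of l] by (cases "l = i + n") (auto simp: block_label_def)
      show "block_label (insert ?y M) B (insert ?x C) (v l) = Inr 1" if "i + n + 1 \<le> l" "l < i + d + 2" for l
        using that in_B[of l] dj by (auto simp: block_label_def)
      show "block_label (insert ?y M) B (insert ?x C) (v l) = Inr 2" if "i + d + 2 \<le> l" "l < i + 1 + k" for l
        using that in_C'[of l] dj by (auto simp: block_label_def)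
    qed (use links dj n k_eq in auto)
    show "cut_weight V \<alpha> (block_label (insert ?x M) (insert ?y B) C) = \<kappa>"
    proof (rule cut_weight_three_intervals[of _ _ _ i "i + n" "i + d + 2" "Inr 0" "Inr 1" "Inr 2"])
      show "block_label (insert ?x M) (insert ?y B) C (v l) = Inr 0" if "i \<le> l" "l < i + n" for l
        using that in_M[of l] by (cases "l = i") (auto simp: block_label_def)
      show "block_label (insert ?x M) (insert ?y B) C (v l) = Inr 1" if "i + n \<le> l" "l < i + d + 2" for l
        using that in_B[of l] dj by (cases "l = i + n") (auto simp: block_label_def)
      show "block_label (insert ?x M) (insert ?y B) C (v l) = Inr 2" if "i + d + 2 \<le> l" "l < i + k" for l
        using that in_C[of l] dj by (auto simp: block_label_def)
    qed (use links dj n k_eq in auto)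
    show "cut_weight V \<alpha> (block_label M (insert ?y B) (insert ?x C)) = \<kappa>"
    proof (rule cut_weight_three_intervals[of _ _ _ "i + 1" "i + n" "i + d + 2" "Inr 0" "Inr 1" "Inr 2"])
      show "block_label M (insert ?y B) (insert ?x C) (v l) = Inr 0" if "i + 1 \<le> l" "l < i + n" for l
        using that in_M[of l] by (auto simp: block_label_def)
      show "block_label M (insert ?y B) (insert ?x C) (v l) = Inr 1" if "i + n \<le> l" "l < i + d + 2" for l
        using that in_B[of l] dj \<open>?y \<notin> M\<close> by (cases "l = i + n") (auto simp: block_label_def)
      show "block_label M (insert ?y B) (insert ?x C) (v l) = Inr 2" if "i + d + 2 \<le> l" "l < i + 1 + k" for l
        using that in_C'[of l] dj \<open>?x \<notin> M\<close> by (auto simp: block_label_def)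
    qed (use links dj \<open>?x \<notin> M\<close> \<open>?y \<notin> M\<close> n k_eq in auto)
  qed (use dj w_in xy in auto)
qed

text \<open>The connecting walk meets exactly the terminals with indices \<open>i\<close> to
  \<open>j - 1\<close>, which is \<open>t = j - i\<close> of them.\<close>

lemma weight_zero_along_arc:
  assumes X: "approach x X \<zeta>" and Y: "approach y Y \<eta>" and ord: "\<zeta> \<le> \<eta>" "\<eta> < \<zeta> + m"
    and xy: "x \<noteq> y" "x \<notin> set Y" "y \<notin> set X" and nt: "x \<notin> range v" "y \<notin> range v"
    and i: "q (i - 1) < \<zeta>" "\<zeta> \<le> q i" and j: "q (j - 1) \<le> \<eta>" "\<eta> < q j" and "j - i \<le> d + 1"
  shows "\<alpha> {x, y} = 0"
proof -
  from connecting_walk[OF X Y ord xy] obtain ps where ps: "walk E (x # ps @ [y])"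
    "x \<notin> set ps" "y \<notin> set ps" "insert x (insert y (set ps)) = set X \<union> arc \<zeta> \<eta> \<union> set Y" .
  have "q (i - 1) < q j" using i j ord by linarith
  then have "i \<le> j" by simp
  show ?thesis
  proof (rule weight_zero_nonterminals[of x ps y "j - i" i])
    fix l assume "i \<le> l" "l < i + (j - i)"
    then have "q i \<le> q l" "q l \<le> q (j - 1)" by simp_all
    then have "v l \<in> arc \<zeta> \<eta>" using i j by (intro in_arc) linarith+
    then have "v l \<in> insert x (insert y (set ps))" unfolding ps(4) by blast
    then show "v l \<in> set ps" using nt by blast
  next
    have "arc \<zeta> \<eta> \<inter> arc (q j) (q (i + k - 1)) = {}"
      using i j q_period[of "i - 1"] by (intro arc_disjoint) (auto simp: algebra_simps)
    then have "insert x (insert y (set ps)) \<inter> arc (q j) (q (i + k - 1)) = {}"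
      unfolding ps(4) using X Y by (auto simp: approach_def)
    then show "set (x # ps @ [y]) \<inter> arc (q (i + (j - i))) (q (i + k - 1)) = {}" by simp
  qed (use ps xy \<open>i \<le> j\<close> assms in auto)
qed

text \<open>The arc now ends at the terminal \<open>v j\<close> itself, so the block has the
  terminals from \<open>i\<close> to \<open>j\<close>, and \<open>t = j - i + 1\<close>.\<close>

lemma weight_zero_along_arc_terminal:
  assumes X: "approach x X \<zeta>" and ord: "\<zeta> \<le> q j" "q j < \<zeta> + m"
    and nt: "x \<notin> range v" and i: "q (i - 1) < \<zeta>" "\<zeta> \<le> q i" and "j - i \<le> d"
  shows "\<alpha> {x, v j} = 0"
proof -
  have xy: "x \<noteq> v j" "x \<notin> set []" "v j \<notin> set X" using nt X by (auto simp: approach_def)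
  from connecting_walk[OF X approach_cycle ord xy] obtain ps where ps: "walk E (x # ps @ [v j])"
    "x \<notin> set ps" "v j \<notin> set ps" "insert x (insert (v j) (set ps)) = set X \<union> arc \<zeta> (q j)" by auto
  have "q (i - 1) < q j" using i ord by linarith
  then have "i \<le> j" by simp
  show ?thesis
  proof (rule weight_zero_terminal_forward[of x ps j "j - i + 1"])
    fix l assume l: "j - (j - i + 1) < l" "l < j"
    then have "q i \<le> q l" "q l \<le> q j" by simp_all
    then have "v l \<in> arc \<zeta> (q j)" using i by (intro in_arc) linarith+
    then have "v l \<in> insert x (insert (v j) (set ps))" unfolding ps(4) by blast
    moreover have "v l \<noteq> v j" using l assms k_eq d_ge by (intro v_distinct) auto
    ultimately show "v l \<in> set ps" using nt by blast
  next
    have "arc \<zeta> (q j - 1) \<inter> arc (q j) (q (i - 1) + m) = {}"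
      using i by (intro arc_disjoint) auto
    moreover have "set (x # ps) \<subseteq> (set X \<union> arc \<zeta> (q j)) - {v j}"
      unfolding ps(4)[symmetric] using ps(3) xy by auto
    then have "set (x # ps) \<subseteq> set X \<union> arc \<zeta> (q j - 1)"
      unfolding insert_arc_last[OF ord(1), symmetric] by blast
    moreover have "set X \<inter> range w = {}" using X by (simp add: approach_def)
    ultimately have "set (x # ps) \<inter> arc (q j) (q (i - 1) + m) = {}" by blast
    then show "set (x # ps) \<inter> arc (q j) (q (j - (j - i + 1)) + m) = {}" by simp
  qed (use ps xy \<open>i \<le> j\<close> assms in auto)
qed

text \<open>Reversing the orientation of the cycle preserves tightness, so each forward result also
  holds backwards.\<close>

lemma reflected: "tight_weights V E (\<lambda>u. w (- u)) (\<lambda>i. - q (- i)) m k d \<alpha> \<kappa>"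
proof
  show "w (- a) = w (- b) \<longleftrightarrow> m dvd a - b" for a b
    using w_eq_iff[of "- a" "- b"] by (simp add: dvd_diff_commute)
  show "{w (- u), w (- (u + 1))} \<in> E" for u
    using w_edge[of "- u - 1"] by (simp add: insert_commute)
  show "strict_mono (\<lambda>i. - q (- i))" by (rule strict_monoI) simp
  show "- q (- (i + k)) = - q (- i) + m" for i using q_period[of "- i - k"] by simp
  show "cut_weight V \<alpha> g = \<kappa>" if "connected_fibres V E g"
    "excess k d (\<lambda>i. g (w (- (- q (- i))))) = k - 3" for g :: "'v \<Rightarrow> 'v + nat"
    using that excess_reflect[of k "\<lambda>i. g (v i)" d] k_eq d_ge v_period
    by (intro cut_const) auto
qed (use conn k_eq d_ge w_in in auto)

text \<open>One of the two arcs between the landing position of \<open>x\<close> and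
  \<open>v j\<close> has at most \<open>d + 1\<close> terminals; the backward arc is treated in the
  reflected locale.\<close>

lemma weight_zero_terminal:
  assumes x: "x \<in> V" "x \<notin> range v"
  shows "\<alpha> {x, v j} = 0"
proof -
  obtain X \<zeta> where X: "approach x X \<zeta>" "\<zeta> \<le> q j" "q j < \<zeta> + m"
    using approach_normalised[OF x(1)] .
  obtain i where i: "q (i - 1) < \<zeta>" "\<zeta> \<le> q i" using index_exists by blast
  show ?thesis
  proof (cases "j - i \<le> d")
    case True
    then show ?thesis using weight_zero_along_arc_terminal X x i by blast
  next
    case False
    interpret R: tight_weights V E "\<lambda>u. w (- u)" "\<lambda>i. - q (- i)" m k d \<alpha> \<kappa>
      by (rule reflected)
    have "q i < q j" using False d_ge by simp
    \<comment> \<open>\<open>- l\<close> is the index of the last terminal at or before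
      \<open>\<zeta> + m\<close>, hence at most \<open>i + k\<close>. The backward arc to
      \<open>v j\<close> has the terminals from \<open>j\<close> to \<open>- l\<close>, at most
      \<open>k - d\<close> of them.\<close>
    obtain l where "- q (- (l - 1)) < - (\<zeta> + m)" "- (\<zeta> + m) \<le> - q (- l)"
      using R.index_exists by blast
    note l = this
    have "q (- l) \<le> q (i + k)" using l i by (simp add: q_period)
    then have "- j - l \<le> d" using False k_eq by simp
    have "w u \<in> range (\<lambda>u. w (- u))" for u using rangeI[of "\<lambda>u. w (- u)" "- u"] by simp
    then have "range (\<lambda>u. w (- u)) = range w" by blast
    then have "R.approach x X (- (\<zeta> + m))"
      using X(1) w_period[of \<zeta>] unfolding R.approach_def approach_def by (simp add: add.commute)
    from R.weight_zero_along_arc_terminal[OF this, of "- j" l] have "\<alpha> {x, w (- (- q (- (- j))))} = 0"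
      using X l x \<open>q i < q j\<close> i \<open>- j - l \<le> d\<close> by force
    then show ?thesis by simp
  qed
qed

text \<open>The part of \<open>X\<close> from \<open>x\<close> to \<open>y\<close> avoids the cycle,
  so this is the case of a block without terminals.\<close>

lemma weight_zero_through:
  assumes X: "approach x X \<zeta>" and "y \<in> set X" "x \<noteq> y"
  shows "\<alpha> {x, y} = 0"
proof -
  obtain as bs where s: "X = as @ y # bs" "y \<notin> set as" using assms(2) by (meson split_list_first)
  then obtain ps where as: "as = x # ps" using X assms(3) by (cases as) (auto simp: approach_def)
  have "walk E ((x # ps @ [y]) @ bs @ [w \<zeta>])" using X s as by (simp add: approach_def)
  then have "walk E (x # ps @ [y])" unfolding successively_append_iff by blast
  then show ?thesis
    by (rule weight_zero_nonterminals[where t = 0 and i = 0])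
      (use X s as assms d_ge in \<open>auto simp: approach_def\<close>)
qed

text \<open>For a non-terminal \<open>y\<close>, either one vertex lies on the other's approach, or
  the two approaches are joined along an arc with few terminals.\<close>

lemma weight_zero_nonterminal:
  assumes x: "x \<in> V" "x \<notin> range v" and y: "y \<in> V" "x \<noteq> y"
  shows "\<alpha> {x, y} = 0"
proof (cases "y \<in> range v")
  case True
  then show ?thesis using weight_zero_terminal x by auto
next
  case False
  obtain Y \<eta> where Y: "approach y Y \<eta>" using approach_exists y by blast
  obtain X \<zeta> where X: "approach x X \<zeta>" "\<zeta> \<le> \<eta>" "\<eta> < \<zeta> + m"
    using approach_normalised[OF x(1)] .
  consider "y \<in> set X" | "x \<in> set Y" | "y \<notin> set X" "x \<notin> set Y" by blast
  then show ?thesis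
  proof cases
    case 1
    then show ?thesis using weight_zero_through X y by blast
  next
    case 2
    then show ?thesis using weight_zero_through[OF Y] y by (simp add: insert_commute)
  next
    case 3
    obtain i where i: "q (i - 1) < \<zeta>" "\<zeta> \<le> q i" using index_exists by blast
    obtain j where j: "q (j - 1) \<le> \<eta>" "\<eta> < q j" using index_exists[of "\<eta> + 1"] by auto
    show ?thesis
    proof (cases "j - i \<le> d + 1")
      case True
      show ?thesis
        by (rule weight_zero_along_arc[OF X(1) Y X(2,3) y(2) 3(2,1) x(2) False i j True])
    next
      case far: False
      \<comment> \<open>The complementary arc runs from \<open>\<eta>\<close> to
        \<open>\<zeta> + m\<close>. Both end positions may be terminals and are then counted by both
        arcs; the two counts add up to at most \<open>k + 2 = 2 * d + 3\<close>, so one is at most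
        \<open>d + 1\<close>.\<close>
      obtain i' where i': "q (i' - 1) < \<eta>" "\<eta> \<le> q i'" using index_exists by blast
      obtain j' where j': "q (j' - 1) \<le> \<zeta> + m" "\<zeta> + m < q j'"
        using index_exists[of "\<zeta> + m + 1"] by auto
      have "q i < q (j - 1)" using far d_ge by simp
      then have lt: "\<zeta> < \<eta>" using i j by linarith
      have "q (j' - 1) \<le> q (i + k)" using i j' by (simp add: q_period)
      moreover have "q (j - 1) \<le> q i'" using j i' by linarith
      ultimately have near: "j' - i' \<le> d + 1" using far k_eq by simp
      have "approach x X (\<zeta> + m)" using X(1) by (rule approach_shift) simp
      then have "\<alpha> {y, x} = 0"
        by (rule weight_zero_along_arc[OF Y _ _ _ _ _ _ _ _ i' j' near]) (use X lt y 3 x False in auto)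
      then show ?thesis by (simp add: insert_commute)
    qed
  qed
qed

section \<open>Relations between the weights of steps and chords\<close>

lemma sum_weight_arc:
  assumes "x = v i" and S: "S = arc a b" "x \<notin> S"
    and J: "finite J" "inj_on v J" "\<And>l. l \<in> J \<Longrightarrow> v l \<in> S"
    and zero: "\<And>l. a \<le> q l \<Longrightarrow> q l \<le> b \<Longrightarrow> l \<notin> J \<Longrightarrow> \<alpha> {x, v l} = 0"
  shows "(\<Sum>z\<in>S. \<alpha> {x, z}) = (\<Sum>l\<in>J. \<alpha> {x, v l})"
proof -
  have "(\<Sum>l\<in>J. \<alpha> {x, v l}) = (\<Sum>z\<in>v ` J. \<alpha> {x, z})"
    using J by (simp add: sum.reindex)
  also have "\<dots> = (\<Sum>z\<in>S. \<alpha> {x, z})"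
  proof (rule sum.mono_neutral_left)
    \<comment> \<open>Non-terminals contribute nothing by \<open>weight_zero_nonterminal\<close>,
      terminals outside \<open>J\<close> by \<open>zero\<close>.\<close>
    show "\<forall>z\<in>S - v ` J. \<alpha> {x, z} = 0"
    proof
      fix z assume z: "z \<in> S - v ` J"
      show "\<alpha> {x, z} = 0"
      proof (cases "z \<in> range v")
        case True
        obtain u where u: "z = w u" "a \<le> u" "u \<le> b" using z S by auto
        then obtain l where "u = q l" using True terminal_position by auto
        then show ?thesis using zero[of l] u z by auto
      next
        case False
        then show ?thesis using weight_zero_nonterminal[of z x] z S assms(1) w_in
          by (auto simp: insert_commute)
      qed
    qed
  qed (use J in auto)
  finally show ?thesis by simp
qed

text \<open>Making \<open>v i\<close> a singleton turns intervals of sizes \<open>d + 1\<close>,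
  \<open>d\<close> into \<open>1\<close>, \<open>d\<close>, \<open>d\<close>. Its total weight to
  the block it leaves is therefore zero, and only the nearest and the farthest terminal of that
  block can have nonzero weight.\<close>

lemma weight_step_plus_chord: "\<alpha> {v i, v (i + 1)} + \<alpha> {v i, v (i + d)} = 0"
proof -
  define M where "M = arc (q i + 1) (q (i + d))"
  define B where "B = arc (q (i + d + 1)) (q (i + 2 * d))"
  have lt: "q i < q (i + d)" "q (i + d) < q (i + d + 1)" "q (i + d) < q (i + 2 * d)" "q (i + 2 * d) < q (i + k)" "q (i + k) = q i + m"
    using d_ge k_eq q_period[of i] q_less_iff[of "i + 2 * d" "i + k"] by auto
  have xM: "insert (v i) M = arc (q i) (q (i + d))"
    unfolding M_def using lt by (intro insert_arc_first) linarith
  have links: "linked M" "linked (insert (v i) M)" "linked B"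
    unfolding xM unfolding M_def B_def by (rule linked_arc)+
  have dj: "insert (v i) M \<inter> B = {}"
    unfolding xM B_def by (rule arc_disjoint; use lt in linarith)
  have vM: "v i \<notin> M"
    unfolding M_def by (rule notin_arc_after; use lt in linarith)
  have in_M: "v l \<in> M" if "i < l" "l \<le> i + d" for l
    using that q_less_iff[of i l] unfolding M_def by (intro in_arc) (auto simp del: q_less_iff)
  have in_B: "v l \<in> B" if "i + d < l" "l < i + k" for l
    using that k_eq unfolding B_def by (intro in_arc) auto
  let ?h = "block_label M B {}"
  have lab: "block_label (insert (v i) M) B {} (v l) = Inr 1" "?h (v l) = Inr 1" if "i + d < l" "l < i + k" for l
    using in_B[OF that] dj by (auto simp: block_label_def)
  have labM: "?h (v l) = Inr 0" if "i < l" "l \<le> i + d" for l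
    using in_M[OF that] by (auto simp: block_label_def)
  have labM': "block_label (insert (v i) M) B {} (v l) = Inr 0" if "i \<le> l" "l \<le> i + d" for l
    using in_M[of l] that by (cases "l = i") (auto simp: block_label_def)
  have labi: "?h (v l) = Inl (v i)" if "i \<le> l" "l < i + 1" for l
    using that vM dj by (auto simp: block_label_def antisym)
  have labM2: "block_label (insert (v i) M) B {} (v l) = Inr 0"
    if "i + d + 1 + d \<le> l" "l < i + d + 1 + k" for l
    using labM'[of "l - k"] v_period[of "l - k"] that k_eq by simp
  have "cut_weight V \<alpha> (block_label (insert (v i) M) B {}) = \<kappa>"
    by (rule cut_weight_two_intervals[of _ _ _ "i + d + 1" "Inr 1" "Inr 0"])
      (use links dj lab(1) labM2 k_eq in auto)
  moreover have "cut_weight V \<alpha> ?h = \<kappa>"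
    by (rule cut_weight_three_intervals[of _ _ _ i "i + 1" "i + d + 1" "Inl (v i)" "Inr 0" "Inr 1"])
      (use links dj lab(2) labM labi k_eq d_ge in auto)
  moreover have "?h(v i := Inr 0) = block_label (insert (v i) M) B {}" "?h(v i := Inl (v i)) = ?h"
    using vM dj by (auto simp: block_label_def)
  ultimately have "(\<Sum>z | z \<in> V - {v i} \<and> ?h z = Inr 0. \<alpha> {v i, z}) =
      (\<Sum>z | z \<in> V - {v i} \<and> ?h z = Inl (v i). \<alpha> {v i, z})"
    using w_in by (intro cut_weight_move) auto
  also have "{z. z \<in> V - {v i} \<and> ?h z = Inl (v i)} = {}"
    by (auto simp: block_label_def split: if_splits)
  also have "{z. z \<in> V - {v i} \<and> ?h z = Inr 0} = M"
    using links vM by (auto simp: block_label_def linked_def split: if_splits)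
  also have "(\<Sum>z\<in>M. \<alpha> {v i, z}) = (\<Sum>l\<in>{i + 1, i + d}. \<alpha> {v i, v l})"
  proof (rule sum_weight_arc[OF refl M_def vM])
    show "inj_on v {i + 1, i + d}"
      using v_distinct[of "i + 1" "i + d"] d_ge k_eq by (auto simp: inj_on_def)
    show "v l \<in> M" if "l \<in> {i + 1, i + d}" for l using that in_M d_ge by auto
    show "\<alpha> {v i, v l} = 0" if "q i + 1 \<le> q l" "q l \<le> q (i + d)" "l \<notin> {i + 1, i + d}" for l
    proof -
      have "i < l" using that(1) q_less_iff[of i l] by linarith
      then show ?thesis using weight_zero_terminals[of "l - i" i] that by auto
    qed
  qed simp
  finally show ?thesis using d_ge by simp
qed

text \<open>Moving \<open>v i\<close> from the block of \<open>v (i + 1)\<close> to the preceding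
  one turns interval sizes \<open>2\<close>, \<open>d\<close>, \<open>d - 1\<close> into
  \<open>1\<close>, \<open>d\<close>, \<open>d\<close>. Only the neighbours \<open>v (i + 1)\<close>
  and \<open>v (i - 1)\<close> can contribute.\<close>

lemma weight_step_const: "\<alpha> {v i, v (i + 1)} = \<alpha> {v (i - 1), v i}"
proof -
  define M where "M = arc (q i + 1) (q (i + 1))"
  define B where "B = arc (q (i + 2)) (q (i + d + 1))"
  define C where "C = arc (q (i + d + 2)) (q (i + k) - 1)"
  have lt: "q i < q (i + 1)" "q (i + 1) < q (i + 2)" "q (i + 2) < q (i + d + 1)"
    "q (i + d + 1) < q (i + d + 2)" "q (i + d + 2) < q (i + k)" "q (i + k) = q i + m"
    using d_ge k_eq q_period[of i] q_less_iff[of "i + d + 2" "i + k"] by auto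
  have xM: "insert (v i) M = arc (q i) (q (i + 1))"
    unfolding M_def using lt by (intro insert_arc_first) linarith
  have xC: "insert (v i) C = arc (q (i + d + 2)) (q (i + k))"
    unfolding C_def v_period[of i, symmetric] using lt by (intro insert_arc_last) linarith
  have links: "linked M" "linked (insert (v i) M)" "linked B" "linked C" "linked (insert (v i) C)"
    unfolding xM xC unfolding M_def B_def C_def by (rule linked_arc)+
  have dj: "insert (v i) M \<inter> B = {}" "insert (v i) M \<inter> C = {}" "B \<inter> insert (v i) C = {}"
    unfolding xM xC unfolding B_def C_def by (rule arc_disjoint; use lt in linarith)+
  have vM: "v i \<notin> M"
    unfolding M_def by (rule notin_arc_after; use lt in linarith)
  have in_M: "v (i + 1) \<in> M"
    using lt unfolding M_def by (intro in_arc) linarith+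
  have in_B: "v l \<in> B" if "i + 2 \<le> l" "l < i + d + 2" for l
    using that unfolding B_def by (intro in_arc) auto
  have in_C: "v l \<in> C" if "i + d + 2 \<le> l" "l < i + k" for l
    using that q_less_iff[of l "i + k"] unfolding C_def by (intro in_arc) (auto simp del: q_less_iff)
  let ?h = "block_label M B C"
  have 1: "cut_weight V \<alpha> (block_label (insert (v i) M) B C) = \<kappa>"
  proof (rule cut_weight_three_intervals[of _ _ _ i "i + 2" "i + d + 2" "Inr 0" "Inr 1" "Inr 2"])
    show "block_label (insert (v i) M) B C (v l) = Inr 0" if "i \<le> l" "l < i + 2" for l
    proof -
      from that have "l = i \<or> l = i + 1" by linarith
      then show ?thesis using in_M by (auto simp: block_label_def)
    qed
    show "block_label (insert (v i) M) B C (v l) = Inr 1" if "i + 2 \<le> l" "l < i + d + 2" for l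
      using in_B[OF that] dj by (auto simp: block_label_def)
    show "block_label (insert (v i) M) B C (v l) = Inr 2" if "i + d + 2 \<le> l" "l < i + k" for l
      using in_C[OF that] dj by (auto simp: block_label_def)
  qed (use links dj k_eq d_ge in auto)
  have 2: "cut_weight V \<alpha> (block_label M B (insert (v i) C)) = \<kappa>"
  proof (rule cut_weight_three_intervals[of _ _ _ "i + 1" "i + 2" "i + d + 2" "Inr 0" "Inr 1" "Inr 2"])
    show "block_label M B (insert (v i) C) (v l) = Inr 0" if "i + 1 \<le> l" "l < i + 2" for l
      using that in_M by (cases "l = i + 1") (auto simp: block_label_def)
    show "block_label M B (insert (v i) C) (v l) = Inr 1" if "i + 2 \<le> l" "l < i + d + 2" for l
      using in_B[OF that] dj by (auto simp: block_label_def)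
    show "block_label M B (insert (v i) C) (v l) = Inr 2" if "i + d + 2 \<le> l" "l < i + 1 + k" for l
    proof -
      have "v l \<in> insert (v i) C" using that in_C[of l] v_period[of i] by (cases "l = i + k") auto
      then show ?thesis using dj vM by (auto simp: block_label_def)
    qed
  qed (use links dj vM k_eq d_ge in auto)
  have "?h(v i := Inr 0) = block_label (insert (v i) M) B C" "?h(v i := Inr 2) = block_label M B (insert (v i) C)"
    using vM dj by (auto simp: block_label_def)
  then have "(\<Sum>z | z \<in> V - {v i} \<and> ?h z = Inr 0. \<alpha> {v i, z}) =
      (\<Sum>z | z \<in> V - {v i} \<and> ?h z = Inr 2. \<alpha> {v i, z})"
    using 1 2 w_in by (intro cut_weight_move) auto
  also have "{z. z \<in> V - {v i} \<and> ?h z = Inr 0} = M"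
    using links vM by (auto simp: block_label_def linked_def split: if_splits)
  also have "{z. z \<in> V - {v i} \<and> ?h z = Inr 2} = C"
    using links dj by (auto simp: block_label_def linked_def split: if_splits)
  also have "(\<Sum>z\<in>M. \<alpha> {v i, z}) = (\<Sum>l\<in>{i + 1}. \<alpha> {v i, v l})"
  proof (rule sum_weight_arc[OF refl M_def vM])
    show "\<alpha> {v i, v l} = 0" if "q i + 1 \<le> q l" "q l \<le> q (i + 1)" "l \<notin> {i + 1}" for l
    proof -
      have "i < l" using that(1) q_less_iff[of i l] by linarith
      then show ?thesis using that by auto
    qed
  qed (use in_M in auto)
  also have "(\<Sum>z\<in>C. \<alpha> {v i, z}) = (\<Sum>l\<in>{i + k - 1}. \<alpha> {v i, v l})"
  proof (rule sum_weight_arc[OF refl C_def])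
    show "v i \<notin> C" using dj by auto
    show "\<alpha> {v i, v l} = 0" if "q (i + d + 2) \<le> q l" "q l \<le> q (i + k) - 1" "l \<notin> {i + k - 1}" for l
    proof -
      have "l < i + k" using that(2) q_less_iff[of l "i + k"] by linarith
      \<comment> \<open>Measured from \<open>v l\<close> forward to \<open>v (i + k) = v i\<close>,
        the distance lies between \<open>2\<close> and \<open>d - 1\<close>.\<close>
      then have "\<alpha> {v l, v (l + (i + k - l))} = 0"
        using that k_eq by (intro weight_zero_terminals) auto
      then show ?thesis using v_period[of i] by (simp add: insert_commute)
    qed
  qed (use in_C k_eq d_ge in auto)
  finally show ?thesis using v_period[of "i - 1"] by (simp add: insert_commute algebra_simps)
qed

lemma weights_vanish:
  assumes sum0: "(\<Sum>i\<in>{0..<k}. \<alpha> {v i, v (i + d)} - \<alpha> {v i, v (i + 1)}) = 0" and e: "e \<in> pairs V"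
  shows "\<alpha> e = 0"
proof -
  define \<gamma> where "\<gamma> = \<alpha> {v 0, v 1}"
  have step: "\<alpha> {v i, v (i + 1)} = \<gamma>" for i
  proof (induction i rule: int_induct[where k = 0])
    case (step1 i)
    then show ?case using weight_step_const[of "i + 1"] by simp
  next
    case (step2 i)
    then show ?case using weight_step_const[of i] by simp
  qed (simp add: \<gamma>_def)
  then have chord: "\<alpha> {v i, v (i + d)} = - \<gamma>" for i
    using weight_step_plus_chord[of i] by simp
  have "k > 0" using k_eq d_ge by simp
  \<comment> \<open>The sum in \<open>sum0\<close> is \<open>- 2 * k * \<gamma>\<close>.\<close>
  have "\<gamma> = 0" using sum0 \<open>k > 0\<close> unfolding step chord by simp
  have near: "\<alpha> {v i, v (i + n)} = 0" if "1 \<le> n" "n \<le> d" for i n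
    using weight_zero_terminals[of n i] step[of i] chord[of i] that \<open>\<gamma> = 0\<close>
    by (cases "n = 1"; cases "n = d") auto
  from e obtain a b where ab: "e = {a, b}" "a \<in> V" "b \<in> V" "a \<noteq> b" by (rule pairs_cases)
  show ?thesis
  proof (cases "a \<in> range v \<and> b \<in> range v")
    case True
    then obtain i j where ij: "a = v i" "b = v j" by auto
    \<comment> \<open>The forward distance from \<open>a\<close> to \<open>b\<close>; if it exceeds
      \<open>d\<close>, the distance \<open>k - n\<close> from \<open>b\<close> to \<open>a\<close>
      does not.\<close>
    define n where "n = (j - i) mod k"
    have "j = i + n + k * ((j - i) div k)" unfolding n_def by simp
    then have b: "b = v (i + n)" using ij v_period_mult by metis
    have n: "0 \<le> n" "n < k" unfolding n_def using \<open>k > 0\<close> by simp_all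
    have "n \<noteq> 0" using b ij ab by auto
    show ?thesis
    proof (cases "n \<le> d")
      case True
      then show ?thesis using near[of n i] n \<open>n \<noteq> 0\<close> ij b ab by simp
    next
      case False
      then have "\<alpha> {v (i + n), v (i + n + (k - n))} = 0" using n k_eq by (intro near) auto
      then show ?thesis using ij b ab v_period[of i] by (simp add: insert_commute)
    qed
  next
    case False
    then show ?thesis using weight_zero_nonterminal[of a b] weight_zero_nonterminal[of b a] ab
      by (auto simp: insert_commute)
  qed
qed

end

subsection \<open>The facet\<close>

text \<open>For a partition this is the singleton of the block of \<open>z\<close>, a label obtained
  without choice.\<close>

definition containing_blocks :: "'v set set \<Rightarrow> 'v \<Rightarrow> 'v set set" where
  "containing_blocks P z = {B \<in> P. z \<in> B}"

lemma doubleton_in_lifted_multicut_iff: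
  assumes P: "partition_on V P" and ab: "a \<in> V" "b \<in> V"
  shows "{a, b} \<in> lifted_multicut P \<longleftrightarrow> containing_blocks P a \<noteq> containing_blocks P b"
proof -
  obtain A B where AB: "A \<in> P" "B \<in> P" "a \<in> A" "b \<in> B"
    using partition_onD1[OF P] ab by blast
  have uniq: "S = T" if "S \<in> P" "T \<in> P" "z \<in> S" "z \<in> T" for S T z
    using partition_onD2[OF P] that by (auto simp: disjoint_def)
  have "containing_blocks P a = {A}" "containing_blocks P b = {B}"
    using AB uniq unfolding containing_blocks_def by blast+
  moreover have "{a, b} \<in> lifted_multicut P \<longleftrightarrow> A \<noteq> B"
  proof
    assume "{a, b} \<in> lifted_multicut P"
    then obtain a' b' S T where *: "{a, b} = {a', b'}" "S \<in> P" "T \<in> P" "S \<noteq> T" "a' \<in> S" "b' \<in> T"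
      unfolding lifted_multicut_def by blast
    from *(1) have "a = a' \<and> b = b' \<or> a = b' \<and> b = a'" by (auto simp: doubleton_eq_iff)
    then show "A \<noteq> B" using * uniq AB by metis
  next
    assume "A \<noteq> B"
    then show "{a, b} \<in> lifted_multicut P" unfolding lifted_multicut_def using AB by blast
  qed
  ultimately show ?thesis by simp
qed

lemma lifted_multicut_subset_pairs:
  assumes "partition_on V P"
  shows "lifted_multicut P \<subseteq> pairs V"
proof
  fix e assume "e \<in> lifted_multicut P"
  then obtain a b A B where *: "e = {a, b}" "A \<in> P" "B \<in> P" "A \<noteq> B" "a \<in> A" "b \<in> B"
    unfolding lifted_multicut_def by blast
  moreover from * have "a \<noteq> b" using partition_onD2[OF assms] by (auto simp: disjoint_def)
  ultimately show "e \<in> pairs V" using partition_onD1[OF assms] by (auto simp: doubleton_in_pairs_iff)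
qed

definition fibre_partition :: "'v set \<Rightarrow> ('v \<Rightarrow> 'l) \<Rightarrow> 'v set set" where
  "fibre_partition V g = (\<lambda>z. {u \<in> V. g u = g z}) ` V"

lemma partition_on_fibres: "partition_on V (fibre_partition V g)"
  by (rule partition_onI) (auto simp: fibre_partition_def disjnt_def)

lemma decomposition_fibres: "connected_fibres V E g \<Longrightarrow> decomposition V E (fibre_partition V g)"
  unfolding decomposition_def
  by (auto simp: connected_fibres_def partition_on_fibres) (auto simp: fibre_partition_def)

lemma containing_blocks_fibres:
  assumes "a \<in> V" "b \<in> V"
  shows "containing_blocks (fibre_partition V g) a = containing_blocks (fibre_partition V g) b \<longleftrightarrow> g a = g b"
proof -
  have "containing_blocks (fibre_partition V g) z = {{u \<in> V. g u = g z}}" if "z \<in> V" for z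
    using that by (auto simp: containing_blocks_def fibre_partition_def)
  then show ?thesis using assms by auto
qed

lemma cut_weight_eq_inner:
  fixes a :: "real ^ ('v::finite set)"
  assumes "\<And>e. e \<notin> pairs V \<Longrightarrow> a $ e = 0"
  shows "cut_weight V (($) a) g = a \<bullet> char_vec (lifted_multicut (fibre_partition V g))"
proof -
  have "a \<bullet> char_vec (lifted_multicut (fibre_partition V g)) =
      (\<Sum>e\<in>pairs V. a $ e * char_vec (lifted_multicut (fibre_partition V g)) $ e)"
    unfolding inner_vec_def inner_real_def using assms by (intro sum.mono_neutral_right) auto
  also have "\<dots> = cut_weight V (($) a) g"
    unfolding cut_weight_def
  proof (rule sum.cong)
    fix e assume "e \<in> pairs V"
    then obtain x y where "e = {x, y}" "x \<in> V" "y \<in> V" by (rule pairs_cases)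
    then show "a $ e * char_vec (lifted_multicut (fibre_partition V g)) $ e = a $ e * of_bool (separates g e)"
      using doubleton_in_lifted_multicut_iff[OF partition_on_fibres, of x V y g]
        containing_blocks_fibres[of x V y g]
      by (simp add: char_vec_def)
  qed simp
  finally show ?thesis by simp
qed

section \<open>The supporting hyperplane and the dimension of its face\<close>

context cyclic_terminals
begin

definition half_chorded :: "real ^ ('v set) \<Rightarrow> real" where
  "half_chorded x = (\<Sum>i\<in>{0..<k}. x $ {v i, v (i + d)} - x $ {v i, v (i + 1)})"

definition normal :: "real ^ ('v set)" where
  "normal = (\<Sum>i\<in>{0..<k}. axis {v i, v (i + d)} 1 - axis {v i, v (i + 1)} 1)"

lemma half_chorded_eq_inner: "half_chorded x = normal \<bullet> x"
  unfolding half_chorded_def normal_def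
  by (simp add: inner_sum_left inner_diff_left inner_axis' )

lemma half_chorded_char_vec:
  assumes "partition_on V P"
  shows "half_chorded (char_vec (lifted_multicut P)) = of_int (excess k d (\<lambda>i. containing_blocks P (v i)))"
  unfolding half_chorded_def excess_def of_int_sum
  using doubleton_in_lifted_multicut_iff[OF assms w_in w_in] by (intro sum.cong) (auto simp: char_vec_def)

lemma containing_blocks_period: "containing_blocks P (v (i + k)) = containing_blocks P (v i)"
  by (simp add: v_period)

text \<open>A half-space is convex, so it suffices to check the generating vectors, where
  \<open>excess_le\<close> applies.\<close>

lemma half_chorded_le:
  assumes "x \<in> LMC V E"
  shows "half_chorded x \<le> of_int k - 3"
proof -
  have "LMC V E \<subseteq> {x. normal \<bullet> x \<le> of_int k - 3}"
    unfolding LMC_def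
  proof (rule hull_minimal)
    show "{char_vec (lifted_multicut P) |P. decomposition V E P} \<subseteq> {x. normal \<bullet> x \<le> of_int k - 3}"
    proof clarsimp
      fix P assume "decomposition V E P"
      then have "partition_on V P" by (simp add: decomposition_def)
      moreover have "excess k d (\<lambda>i. containing_blocks P (v i)) \<le> k - 3"
        using k_eq d_ge containing_blocks_period by (intro excess_le) auto
      then have "real_of_int (excess k d (\<lambda>i. containing_blocks P (v i))) \<le> of_int (k - 3)"
        by (simp only: of_int_le_iff)
      ultimately show "normal \<bullet> char_vec (lifted_multicut P) \<le> of_int k - 3"
        by (simp add: half_chorded_char_vec half_chorded_eq_inner[symmetric])
    qed
  qed (rule convex_halfspace_le)
  then show ?thesis using assms by (auto simp: half_chorded_eq_inner)
qed

lemma char_vec_in_LMC: "decomposition V E P \<Longrightarrow> char_vec (lifted_multicut P) \<in> LMC V E"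
  unfolding LMC_def by (intro hull_inc) auto

text \<open>The decomposition into the single block \<open>V\<close> cuts nothing. As
  \<open>0\<close> is not tight, it shows that the face is proper.\<close>

lemma zero_in_LMC: "0 \<in> LMC V E"
proof -
  have "induced_edges E V = E"
    using conn by (auto simp: connected_graph_def simple_graph_def induced_edges_def pairs_def)
  moreover have "partition_on V {V}" using conn by (intro partition_onI) (auto simp: connected_graph_def)
  ultimately have "decomposition V E {V}" using conn by (simp add: decomposition_def)
  moreover have "char_vec (lifted_multicut {V}) = 0"
    by (simp add: vec_eq_iff char_vec_def lifted_multicut_def)
  ultimately show ?thesis using char_vec_in_LMC by metis
qed

definition pair_space :: "(real ^ ('v set)) set" where
  "pair_space = {x. \<forall>e. e \<notin> pairs V \<longrightarrow> x $ e = 0}"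

lemma subspace_pair_space: "subspace pair_space"
  by (auto simp: subspace_def pair_space_def)

lemma dim_pair_space: "dim pair_space = card (pairs V)"
  using dim_substandard_cart[of "pairs V", where 'a = real] by (simp add: pair_space_def dim_vec_eq)

lemma LMC_subset_pair_space: "LMC V E \<subseteq> pair_space"
  unfolding LMC_def
proof (rule hull_minimal)
  show "convex pair_space" by (rule subspace_imp_convex) (rule subspace_pair_space)
qed (use lifted_multicut_subset_pairs in
      \<open>fastforce simp: decomposition_def pair_space_def char_vec_def\<close>)

lemma normal_in_pair_space: "normal \<in> pair_space"
  unfolding normal_def
proof (intro subspace_sum subspace_pair_space subspace_diff)
  fix i assume "i \<in> {0..<k}"
  have "v i \<noteq> v (i + d)" "v i \<noteq> v (i + 1)"
    using k_eq d_ge by (intro v_distinct; simp)+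
  then show "axis {v i, v (i + d)} 1 \<in> pair_space" "axis {v i, v (i + 1)} 1 \<in> pair_space"
    using w_in by (auto simp: pair_space_def axis_def doubleton_in_pairs_iff)
qed

text \<open>Constancy forces \<open>a\<close> to be a multiple of \<open>normal\<close>.
  Orthogonality is the vanishing of \<open>half_chorded a\<close>, which is the sum hypothesis of
  \<open>weights_vanish\<close> and makes the multiple zero.\<close>

lemma functional_constant_on_tight_face:
  assumes a: "a \<in> pair_space" and orth: "a \<bullet> normal = 0"
    and const: "\<And>x. x \<in> LMC V E \<Longrightarrow> half_chorded x = of_int k - 3 \<Longrightarrow> a \<bullet> x = \<kappa>"
  shows "a = 0"
proof -
  have a0: "a $ e = 0" if "e \<notin> pairs V" for e using a that by (simp add: pair_space_def)
  interpret tight_weights V E w q m k d "($) a" \<kappa>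
  proof
    fix g :: "'v \<Rightarrow> 'v + nat"
    assume g: "connected_fibres V E g" "excess k d (\<lambda>i. g (v i)) = k - 3"
    have "excess k d (\<lambda>i. containing_blocks (fibre_partition V g) (v i)) = k - 3"
      using g(2) by (simp add: excess_def containing_blocks_fibres w_in)
    then have "half_chorded (char_vec (lifted_multicut (fibre_partition V g))) = of_int k - 3"
      by (simp add: half_chorded_char_vec[OF partition_on_fibres])
    then show "cut_weight V (($) a) g = \<kappa>"
      using const char_vec_in_LMC[OF decomposition_fibres[OF g(1)]] cut_weight_eq_inner[of V a g] a0 by auto
  qed
  have "half_chorded a = 0" using orth by (simp add: half_chorded_eq_inner inner_commute)
  then have "a $ e = 0" if "e \<in> pairs V" for e
    unfolding half_chorded_def by (rule weights_vanish[OF _ that])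
  then show ?thesis using a0 by (auto simp: vec_eq_iff)
qed

text \<open>This excludes an empty face, whose affine dimension \<open>-1\<close> would be too
  small.\<close>

lemma card_pairs: "card (pairs V) \<ge> 2"
proof -
  have d: "v 0 \<noteq> v 1" "v 0 \<noteq> v 2" "v 1 \<noteq> v 2"
    using k_eq d_ge by (intro v_distinct; simp)+
  then have "card {{v 0, v 1}, {v 0, v 2}} = 2" by (auto simp: doubleton_eq_iff card_insert_if)
  moreover have "{{v 0, v 1}, {v 0, v 2}} \<subseteq> pairs V"
    using d w_in by (auto simp: doubleton_in_pairs_iff)
  moreover have "finite (pairs V)" by (rule finite)
  ultimately show ?thesis by (metis card_mono)
qed

text \<open>Otherwise the directions of the face together with \<open>normal\<close> span a proper
  subspace of \<open>pair_space\<close>. A nonzero vector orthogonal to it would be constant on the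
  face, against \<open>functional_constant_on_tight_face\<close>.\<close>

lemma aff_dim_tight_face_ge:
  "aff_dim {x \<in> LMC V E. half_chorded x = of_int k - 3} \<ge> int (card (pairs V)) - 1"
proof (rule ccontr)
  define F where "F = {x \<in> LMC V E. half_chorded x = of_int k - 3}"
  assume "\<not> ?thesis"
  then have small: "aff_dim F < int (card (pairs V)) - 1" by (simp add: F_def)
  \<comment> \<open>A base point of the face; were the face empty, \<open>S\<close> would be empty
    too and the choice immaterial.\<close>
  define x\<^sub>0 where "x\<^sub>0 = (SOME x. x \<in> F)"
  define S where "S = (\<lambda>x. x - x\<^sub>0) ` F"
  have x0: "x\<^sub>0 \<in> F" if "x \<in> F" for x unfolding x\<^sub>0_def using that by (rule someI)
  have S_sub: "S \<subseteq> pair_space"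
  proof
    fix z assume "z \<in> S"
    then obtain x where x: "x \<in> F" "z = x - x\<^sub>0" unfolding S_def by blast
    have "F \<subseteq> pair_space" using LMC_subset_pair_space by (auto simp: F_def)
    then have "x \<in> pair_space" "x\<^sub>0 \<in> pair_space" using x(1) x0[OF x(1)] by blast+
    then show "z \<in> pair_space" unfolding x(2) by (rule subspace_diff[OF subspace_pair_space])
  qed
  have "dim S + 2 \<le> card (pairs V)"
  proof (cases "F = {}")
    case True
    then show ?thesis using card_pairs unfolding S_def by simp
  next
    case False
    then have "x\<^sub>0 \<in> F" using x0 by blast
    then have "aff_dim F = int (dim ((+) (- x\<^sub>0) ` F))" by (intro aff_dim_eq_dim hull_inc)
    also have "(+) (- x\<^sub>0) ` F = S" unfolding S_def by (rule image_cong) auto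
    finally show ?thesis using small by simp
  qed
  then have "dim (insert normal S) < dim pair_space"
    unfolding dim_pair_space by (simp add: dim_insert)
  moreover have sub: "span (insert normal S) \<subseteq> pair_space"
    using S_sub normal_in_pair_space subspace_pair_space by (intro span_minimal) auto
  ultimately have "span (insert normal S) \<subset> span pair_space"
    using dim_span[of "insert normal S"] subspace_pair_space
    by (metis less_irrefl psubsetI span_eq_iff)
  then obtain a where a: "a \<noteq> 0" "a \<in> span pair_space"
    "\<And>y. y \<in> span (insert normal S) \<Longrightarrow> orthogonal a y"
    using orthogonal_to_subspace_exists_gen by metis
  have "a = 0"
  proof (rule functional_constant_on_tight_face[of a "a \<bullet> x\<^sub>0"])
    show "a \<in> pair_space" using a(2) subspace_pair_space by (metis span_eq_iff)
    show "a \<bullet> normal = 0" using a(3)[of normal] by (simp add: span_base orthogonal_def)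
    show "a \<bullet> x = a \<bullet> x\<^sub>0" if "x \<in> LMC V E" "half_chorded x = of_int k - 3" for x
    proof -
      have "x - x\<^sub>0 \<in> span (insert normal S)" using that unfolding S_def F_def by (intro span_base) auto
      then show ?thesis using a(3) by (fastforce simp: orthogonal_def inner_diff_right)
    qed
  qed
  then show False using a(1) by simp
qed

text \<open>The face has dimension at least \<open>card (pairs V) - 1\<close>, the polytope at most
  \<open>card (pairs V)\<close>, and the face is proper; this fixes both dimensions.\<close>

theorem half_chorded_facet: "facet_defining (LMC V E) half_chorded (of_int k - 3)"
proof -
  let ?F = "{x \<in> LMC V E. half_chorded x = of_int k - 3}"
  have lin: "linear half_chorded"
    unfolding half_chorded_eq_inner[abs_def] by (rule bounded_linear.linear) (rule bounded_linear_inner_right)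
  have cvx: "convex (LMC V E)" by (simp add: LMC_def)
  have "LMC V E \<inter> {x. normal \<bullet> x = of_int k - 3} face_of LMC V E"
    using half_chorded_le by (intro face_of_Int_supporting_hyperplane_le cvx) (simp add: half_chorded_eq_inner)
  moreover have "LMC V E \<inter> {x. normal \<bullet> x = of_int k - 3} = ?F" by (auto simp: half_chorded_eq_inner)
  ultimately have face: "?F face_of LMC V E" by simp
  have "half_chorded 0 = 0" by (simp add: half_chorded_eq_inner)
  then have "0 \<notin> ?F" using k_eq d_ge by simp
  then have "?F \<noteq> LMC V E" using zero_in_LMC by metis
  then have "aff_dim ?F < aff_dim (LMC V E)" using face cvx by (intro face_of_aff_dim_lt)
  moreover have "aff_dim (LMC V E) \<le> int (card (pairs V))"
    using aff_dim_subset[OF LMC_subset_pair_space] aff_dim_subspace[OF subspace_pair_space]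
    by (simp add: dim_pair_space)
  moreover note aff_dim_tight_face_ge
  ultimately have dim: "aff_dim ?F = aff_dim (LMC V E) - 1" by simp
  have "?F \<noteq> {}" using aff_dim_tight_face_ge card_pairs by force
  then show ?thesis
    using lin half_chorded_le face dim by (auto simp: facet_defining_def facet_of_def)
qed

end

section \<open>From the labelled cycle to positions on the integers\<close>

lemma strict_mono_int_step:
  fixes q :: "int \<Rightarrow> int"
  assumes "\<And>i. q i < q (i + 1)"
  shows "strict_mono q"
proof (rule strict_monoI)
  fix i j :: int
  assume "i < j"
  then show "q i < q j"
    by (induction j rule: int_gr_induct) (use assms order.strict_trans in blast)+
qed

lemma cyc_cc_offset:
  assumes "0 < m" "a < m" "b < m" and x: "x \<in> cyc_cc m a b" "x < m"
  obtains j where "int j \<le> (int b - int a) mod int m" "int x = (int a + int j) mod int m"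
proof -
  from x obtain j where j: "x = (a + j) mod m" "j \<le> (b + m - a) mod m" by (auto simp: cyc_cc_def)
  have "int ((b + m - a) mod m) = (int b - int a) mod int m"
    using assms by (simp add: of_nat_mod of_nat_diff) (metis add_diff_eq diff_add_eq mod_add_self2)
  then have "int j \<le> (int b - int a) mod int m" using j(2) by linarith
  moreover have "int x = (int a + int j) mod int m" using j(1) by (simp add: of_nat_mod)
  ultimately show ?thesis by (rule that)
qed

text \<open>Membership in the half-open arc becomes a comparison of forward distances from
  \<open>a\<close>. Hence a forward sequence true to the cycle has strictly increasing distances
  from its first element.\<close>

lemma cyc_co_offset_less:
  assumes "0 < m" "a < m" "b < m" "x < m" "x \<in> cyc_co m a b"
  shows "(int x - int a) mod int m < (int b - int a) mod int m"
proof -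
  from assms have x: "x \<in> cyc_cc m a b" "x \<noteq> b" by (auto simp: cyc_co_def)
  then obtain j where j: "int j \<le> (int b - int a) mod int m" "int x = (int a + int j) mod int m"
    using cyc_cc_offset[of m a b x] assms by blast
  have "int j < int m" using j(1) assms pos_mod_bound[of "int m" "int b - int a"] by linarith
  then have o: "(int x - int a) mod int m = int j" unfolding j(2) by (simp add: mod_diff_left_eq)
  have "int j \<noteq> (int b - int a) mod int m"
  proof
    assume "int j = (int b - int a) mod int m"
    then have "int x = int b mod int m" using j(2) by (simp add: mod_add_right_eq)
    then show False using x assms by simp
  qed
  then show ?thesis using o j(1) by simp
qed

text \<open>The counterpart for the other orientation, with distances counted backwards from
  \<open>a\<close>.\<close>

lemma cyc_oc_offset_less:
  assumes "0 < m" "a < m" "b < m" "x < m" "x \<in> cyc_oc m b a"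
  shows "(int a - int x) mod int m < (int a - int b) mod int m"
proof -
  from assms have x: "x \<in> cyc_cc m b a" "x \<noteq> b" by (auto simp: cyc_oc_def)
  then obtain j where j: "int j \<le> (int a - int b) mod int m" "int x = (int b + int j) mod int m"
    using cyc_cc_offset[of m b a x] assms by blast
  have "(int a - int x) mod int m = ((int a - int b) mod int m - int j) mod int m"
    unfolding j(2) by (simp add: mod_diff_left_eq mod_diff_right_eq algebra_simps)
  also have "\<dots> = (int a - int b) mod int m - int j"
    using j(1) assms(1) pos_mod_bound[of "int m" "int a - int b"] by (intro mod_pos_pos_trivial) linarith+
  moreover have "j \<noteq> 0" using j(2) x assms by (cases "j = 0") auto
  ultimately show ?thesis by simp
qed

text \<open>The sign \<open>\<sigma>\<close> below is the direction in which \<open>v\<close> runs around the cycle.\<close>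

lemma cyclic_terminals_exist:
  fixes V V\<^sub>C :: "'v::finite set" and c v :: "nat \<Rightarrow> 'v"
  assumes conn: "connected_graph V E" and sub: "V\<^sub>C \<subseteq> V" "E\<^sub>C \<subseteq> E"
    and lab: "cycle_labelling c V\<^sub>C E\<^sub>C" and k: "5 \<le> k" "odd k" and d: "d = (k - 1) div 2"
    and v: "v ` {..<k} \<subseteq> V\<^sub>C" and true: "true_to_cycle c V\<^sub>C k v"
  obtains w q where "cyclic_terminals V E w q (int (card V\<^sub>C)) (int k) (int d)"
    and "\<And>i. w (q i) = v (nat (i mod int k))"
proof -
  define m where "m = card V\<^sub>C"
  define p where "p i = the_inv_into {..<m} c (v i)" for i
  have m: "3 \<le> m" and bij: "bij_betw c {..<m} V\<^sub>C"
    and EC: "E\<^sub>C = {{c u, c ((u + 1) mod m)} | u. u < m}"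
    using lab by (auto simp: cycle_labelling_def m_def)
  have p_less: "p i < m" and c_p: "c (p i) = v i" if "i < k" for i
  proof -
    have "v i \<in> V\<^sub>C" using v that by auto
    then show "p i < m" "c (p i) = v i"
      using bij the_inv_into_into[of c "{..<m}" "v i" "{..<m}"] f_the_inv_into_f_bij_betw[OF bij]
      unfolding p_def by (auto simp: bij_betw_def)
  qed
  have p0: "p 0 < m" using p_less k by simp
  obtain \<sigma> :: int where \<sigma>: "\<sigma> = 1 \<or> \<sigma> = - 1"
    and less: "\<And>i. i < k - 1 \<Longrightarrow>
      (\<sigma> * (int (p i) - int (p 0))) mod int m < (\<sigma> * (int (p (i + 1)) - int (p 0))) mod int m"
  proof -
    have "(\<forall>i<k - 1. p i \<in> cyc_co m (p 0) (p (i + 1))) \<or> (\<forall>i<k - 1. p i \<in> cyc_oc m (p (i + 1)) (p 0))"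
      using true unfolding true_to_cycle_def Let_def m_def[symmetric] p_def[symmetric] .
    then show ?thesis
    proof
      assume *: "\<forall>i<k - 1. p i \<in> cyc_co m (p 0) (p (i + 1))"
      show ?thesis
      proof (rule that[of 1])
        fix i assume "i < k - 1"
        then show "(1 * (int (p i) - int (p 0))) mod int m < (1 * (int (p (i + 1)) - int (p 0))) mod int m"
          using cyc_co_offset_less[of m "p 0" "p (i + 1)" "p i"] * m p0 p_less[of i] p_less[of "i + 1"] by simp
      qed simp
    next
      assume *: "\<forall>i<k - 1. p i \<in> cyc_oc m (p (i + 1)) (p 0)"
      show ?thesis
      proof (rule that[of "- 1"])
        fix i assume "i < k - 1"
        then show "(- 1 * (int (p i) - int (p 0))) mod int m < (- 1 * (int (p (i + 1)) - int (p 0))) mod int m"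
          using cyc_oc_offset_less[of m "p 0" "p (i + 1)" "p i"] * m p0 p_less[of i] p_less[of "i + 1"] by simp
      qed simp
    qed
  qed
  \<comment> \<open>Position \<open>0\<close> is that of \<open>v 0\<close>, and positions increase
    in the direction in which \<open>v\<close> runs.\<close>
  define w where "w u = c (nat ((int (p 0) + \<sigma> * u) mod int m))" for u
  define off where "off i = (\<sigma> * (int (p i) - int (p 0))) mod int m" for i
  \<comment> \<open>The offsets from \<open>v 0\<close> within one turn, raised by \<open>m\<close>
    for each full turn of the index.\<close>
  define q where "q i = off (nat (i mod int k)) + int m * (i div int k)" for i
  have mk: "0 < int m" "0 < int k" using m k by auto
  have off_bounds: "0 \<le> off i" "off i < int m" for i using mk by (simp_all add: off_def)
  have w_iff: "w a = w b \<longleftrightarrow> int m dvd a - b" for a b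
  proof -
    have "w a = w b \<longleftrightarrow> nat ((int (p 0) + \<sigma> * a) mod int m) = nat ((int (p 0) + \<sigma> * b) mod int m)"
      unfolding w_def using bij mk by (intro inj_on_eq_iff[of c "{..<m}"]) (auto simp: bij_betw_def nat_less_iff)
    also have "\<dots> \<longleftrightarrow> (int (p 0) + \<sigma> * a) mod int m = (int (p 0) + \<sigma> * b) mod int m"
      using mk by (simp add: nat_eq_iff)
    also have "\<dots> \<longleftrightarrow> int m dvd \<sigma> * (a - b)"
      by (simp add: mod_eq_dvd_iff algebra_simps)
    also have "\<dots> \<longleftrightarrow> int m dvd a - b" using \<sigma> by (auto simp: dvd_diff_commute)
    finally show ?thesis .
  qed
  have w_in: "w u \<in> V\<^sub>C" for u
    unfolding w_def using bij mk by (auto simp: bij_betw_def nat_less_iff)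
  have edge: "{c (nat (x mod int m)), c (nat ((x + 1) mod int m))} \<in> E" for x
  proof -
    define u where "u = nat (x mod int m)"
    have u: "u < m" "int u = x mod int m" using mk by (auto simp: u_def nat_less_iff)
    have "int ((u + 1) mod m) = (x + 1) mod int m" unfolding of_nat_mod of_nat_add u(2) by (simp add: mod_add_left_eq)
    then have "nat ((x + 1) mod int m) = (u + 1) mod m" by linarith
    then show ?thesis using u(1) sub(2) unfolding EC u_def[symmetric] by auto
  qed
  have w_edge: "{w u, w (u + 1)} \<in> E" for u
    using \<sigma>
  proof
    assume "\<sigma> = 1"
    then show ?thesis using edge[of "int (p 0) + u"] by (simp add: w_def algebra_simps)
  next
    assume "\<sigma> = - 1"
    then show ?thesis using edge[of "int (p 0) - u - 1"] by (simp add: w_def algebra_simps insert_commute)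
  qed
  have q_step: "q i < q (i + 1)" for i
  proof (cases "i mod int k = int k - 1")
    case True
    \<comment> \<open>At the end of a turn the offset falls back to \<open>0\<close>, but
      \<open>m\<close> is added, which exceeds every offset.\<close>
    then have "i + 1 = int k * (i div int k + 1) + 0"
      using mult_div_mod_eq[of "int k" i] unfolding distrib_left by linarith
    from int_mod_pos_eq[OF this] int_div_pos_eq[OF this]
    have "(i + 1) mod int k = 0" "(i + 1) div int k = i div int k + 1" using mk by simp_all
    then show ?thesis using off_bounds(2)[of "nat (i mod int k)"]
      by (simp add: q_def off_def algebra_simps)
  next
    case False
    then have lt: "i mod int k + 1 < int k" using pos_mod_bound[of "int k" i] mk by linarith
    have nonneg: "0 \<le> i mod int k + 1" using pos_mod_sign[of "int k" i] mk by linarith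
    have "i + 1 = int k * (i div int k) + (i mod int k + 1)" by simp
    note int_mod_pos_eq[OF this nonneg lt] int_div_pos_eq[OF this nonneg lt]
    moreover have "nat (i mod int k + 1) = nat (i mod int k) + 1" using mk by (simp add: nat_add_distrib)
    moreover have "nat (i mod int k) < k - 1" using lt mk by (simp add: nat_less_iff of_nat_diff)
    ultimately show ?thesis using less[of "nat (i mod int k)"] by (simp add: q_def off_def)
  qed
  have q_period: "q (i + int k) = q i + int m" for i
    using mk by (simp add: q_def algebra_simps)
  have wq: "w (q i) = v (nat (i mod int k))" for i
  proof -
    have lt: "nat (i mod int k) < k" using mk by (simp add: nat_less_iff)
    let ?i = "nat (i mod int k)"
    have "w (q i) = w (off ?i)" by (simp add: w_iff q_def)
    also have "(int (p 0) + \<sigma> * off ?i) mod int m = (int (p 0) + \<sigma> * (\<sigma> * (int (p ?i) - int (p 0)))) mod int m"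
      unfolding off_def by (metis mod_add_right_eq mod_mult_right_eq)
    then have "(int (p 0) + \<sigma> * off ?i) mod int m = int (p ?i)"
      using \<sigma> p_less[OF lt] by auto
    then have "w (off ?i) = v ?i" using c_p[OF lt] by (simp add: w_def)
    finally show ?thesis .
  qed
  have "cyclic_terminals V E w q (int m) (int k) (int d)"
  proof
    show "int k = 2 * int d + 1" "2 \<le> int d" using k d by (auto elim!: oddE)
  qed (use conn w_iff w_in sub w_edge q_period q_step in \<open>auto intro: strict_mono_int_step\<close>)
  then show ?thesis using wq unfolding m_def by (rule that)
qed

theorem theorem7p27:
  fixes V V\<^sub>C :: "'v::finite set"
    and E E\<^sub>C :: "'v set set"
    and c v :: "nat \<Rightarrow> 'v"
    and k d :: nat
  assumes "connected_graph V E"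
    and "V\<^sub>C \<subseteq> V" and "E\<^sub>C \<subseteq> E"
    and "cycle_labelling c V\<^sub>C E\<^sub>C"
    and "5 \<le> k" and "k \<le> card V\<^sub>C" and "odd k"
    and "d = (k - 1) div 2"
    and "v ` {..<k} \<subseteq> V\<^sub>C" and "inj_on v {..<k}"
    and "true_to_cycle c V\<^sub>C k v"
  shows "facet_defining (LMC V E)
    (\<lambda>x. \<Sum>i<k. (x $ {v i, v ((i + d) mod k)} - x $ {v i, v ((i + 1) mod k)}))
    (real k - 3)"
proof -
  obtain w q where cyc: "cyclic_terminals V E w q (int (card V\<^sub>C)) (int k) (int d)"
    and wq: "\<And>i. w (q i) = v (nat (i mod int k))"
    using cyclic_terminals_exist[OF assms(1-5,7-9,11)] by blast
  interpret cyclic_terminals V E w q "int (card V\<^sub>C)" "int k" "int d" by (rule cyc)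
  have "half_chorded x = (\<Sum>i<k. (x $ {v i, v ((i + d) mod k)} - x $ {v i, v ((i + 1) mod k)}))" for x
    unfolding half_chorded_def wq
  proof (rule sum.reindex_bij_witness[of _ int nat])
    fix i assume i: "i \<in> {0..<int k}"
    then obtain n where n: "i = int n" "n < k" by (metis atLeastLessThan_iff nonneg_int_cases of_nat_less_iff)
    have "nat ((int n + int r) mod int k) = (n + r) mod k" for r
      by (metis nat_int of_nat_add of_nat_mod)
    from this[of d] this[of 1]
    show "x $ {v (nat i), v ((nat i + d) mod k)} - x $ {v (nat i), v ((nat i + 1) mod k)} =
      x $ {v (nat (i mod int k)), v (nat ((i + int d) mod int k))} -
      x $ {v (nat (i mod int k)), v (nat ((i + 1) mod int k))}"
      using n by simp
  qed auto
  then have "half_chorded = (\<lambda>x. \<Sum>i<k. (x $ {v i, v ((i + d) mod k)} - x $ {v i, v ((i + 1) mod k)}))"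
    by blast
  then show ?thesis using half_chorded_facet by simp
qed

end
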